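(* Let $(X,x)$ be a pointed topological space and let $\mathbf{p}:(X,x)\to(\mathbf{X},\mathbf{x})=((X_\lambda,x_\lambda),p_{\lambda\lambda'},\Lambda)$ be an $\mathrm{HPol}_*$-expansion of $(X,x)$. Then for every integer $k\ge 1$, $$\check{\pi}_k^{top}(X,x)\cong\varprojlim_{\lambda\in\Lambda}\pi_k^{qtop}(X_\lambda,x_\lambda)$$ as topological groups.
   Context: $\mathrm{HTop}_*$ is the pointed homotopy category of pointed topological spaces; $\mathrm{HPol}_*$ is its full subcategory of pointed spaces having the pointed homotopy type of a pointed polyhedron. Inverse systems are indexed by directed sets. An $\mathrm{HPol}_*$-expansion of $(X,x)$ is an inverse system $(\mathbf{X},\mathbf{x})=((X_\lambda,x_\lambda),p_{\lambda\lambda'},\Lambda)$ in $\mathrm{HPol}_*$ with a morphism $\mathbf{p}=(p_\lambda):(X,x)\to(\mathbf{X},\mathbf{x})$ of pro-$\mathrm{HTop}_*$ (so $p_{\lambda\lambda'}p_{\lambda'}=p_\lambda$ in $\mathrm{HTop}_*$) such that: (E1) for every $P\in \mathrm{HPol}_*$ and every $h:(X,x)\to P$ in $\mathrm{HTop}_*$ there are $\lambda\in\Lambda$ and $f:(X_\lambda,x_\lambda)\to P$ with $fp_\lambda= h$; (E2) if $f_0,f_1:(X_\lambda,x_\lambda)\to P$ satisfy $f_0p_\lambda= f_1p_\lambda$, then $f_0p_{\lambda\lambda'}= f_1p_{\lambda\lambda'}$ for some $\lambda'\ge\lambda$. Every pointed space admits such an expansion. A shape morphism $F:(S^k,* )\to(X,x)$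 is, with an expansion of $(X,x)$ fixed, a family $(f_\lambda)_{\lambda\in\Lambda}$ of pointed homotopy classes $f_\lambda:(S^k,* )\to(X_\lambda,x_\lambda)$ with $p_{\lambda\lambda'}f_{\lambda'}=f_\lambda$ for $\lambda\le\lambda'$ (families for different expansions are identified via the canonical isomorphism of expansions), and $p_\lambda\circ F=f_\lambda$. The $k$th shape group $\check{\pi}_k(X,x)=Sh((S^k,* ),(X,x))$ is the set of these shape morphisms with operation $F+G$ represented by $(f_\lambda+g_\lambda)_\lambda$ (product in $\pi_k(X_\lambda,x_\lambda)$). $\check{\pi}_k^{top}(X,x)$ is this group with the topology having as basis the sets $V_\lambda^F=\{G : p_\lambda\circ F=p_\lambda\circ G \text{ as pointed homotopy classes to } X_\lambda\}$, $F\in Sh((S^k,* ),(X,x))$, $\lambda\in\Lambda$. It is a topological group and does not depend on the choice of expansion. $\pi_k^{qtop}(Z,z)$ is the homotopy group $\pi_k(Z,z)$ with the quotient topology induced by the natural surjection $\Omega^k(Z,z)\to\pi_k(Z,z)$, where the $k$th loop space $\Omega^k(Z,z)$ has the compact-open topology. The bonding maps of the inverse system of groups are the homomorphisms induced by $p_{\lambda\lambda'}$, and the inverse limit carries the inverse limit topology. *)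

theory Defs
  imports "HOL-Analysis.Analysis" "HOL-Algebra.Group"
begin

section \<open>The pointed homotopy category\<close>

type_synonym 'a pspace = "'a topology \<times> 'a"

definition pointed_space :: "'a pspace \<Rightarrow> bool" where
  "pointed_space A \<longleftrightarrow> snd A \<in> topspace (fst A)"

text \<open>Maps are extensional, so that equality of maps is equality on the underlying space.\<close>

definition cmaps :: "'a topology \<Rightarrow> 'b topology \<Rightarrow> ('a \<Rightarrow> 'b) set" where
  "cmaps X Y = {f \<in> extensional (topspace X). continuous_map X Y f}"

definition pmaps :: "'a pspace \<Rightarrow> 'b pspace \<Rightarrow> ('a \<Rightarrow> 'b) set" where
  "pmaps A B = {f \<in> cmaps (fst A) (fst B). f (snd A) = snd B}"

definition phomotopic :: "'a pspace \<Rightarrow> 'b pspace \<Rightarrow> ('a \<Rightarrow> 'b) \<Rightarrow> ('a \<Rightarrow> 'b) \<Rightarrow> bool" where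
  "phomotopic A B = homotopic_with (\<lambda>h. h (snd A) = snd B) (fst A) (fst B)"

definition hclass :: "'a pspace \<Rightarrow> 'b pspace \<Rightarrow> ('a \<Rightarrow> 'b) \<Rightarrow> ('a \<Rightarrow> 'b) set" where
  "hclass A B f = {g \<in> pmaps A B. phomotopic A B f g}"

text \<open>Morphisms of the pointed homotopy category are the homotopy classes themselves.\<close>

definition hTop_hom :: "'a pspace \<Rightarrow> 'b pspace \<Rightarrow> ('a \<Rightarrow> 'b) set set" where
  "hTop_hom A B = hclass A B ` pmaps A B"

definition hTop_id :: "'a pspace \<Rightarrow> ('a \<Rightarrow> 'a) set" where
  "hTop_id A = hclass A A (restrict id (topspace (fst A)))"

text \<open>The composite \<open>d \<circ> c\<close> of \<open>c : A \<rightarrow> B\<close> and \<open>d : B \<rightarrow> C\<close>; only the outer objects \<open>A\<close> and \<open>C\<close>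
  are needed as arguments.\<close>

definition hTop_comp ::
  "'a pspace \<Rightarrow> 'c pspace \<Rightarrow> ('b \<Rightarrow> 'c) set \<Rightarrow> ('a \<Rightarrow> 'b) set \<Rightarrow> ('a \<Rightarrow> 'c) set" where
  "hTop_comp A C d c = (\<Union>f\<in>c. \<Union>g\<in>d. hclass A C (compose (topspace (fst A)) g f))"

definition hTop_isomorphic :: "'a pspace \<Rightarrow> 'b pspace \<Rightarrow> bool" where
  "hTop_isomorphic A B \<longleftrightarrow>
     (\<exists>c \<in> hTop_hom A B. \<exists>d \<in> hTop_hom B A.
        hTop_comp A A d c = hTop_id A \<and> hTop_comp B B c d = hTop_id B)"


section \<open>Polyhedra\<close>

definition abstract_simplicial_complex :: "'v set set \<Rightarrow> bool" where
  "abstract_simplicial_complex K \<longleftrightarrow>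
     (\<forall>\<sigma>\<in>K. finite \<sigma> \<and> \<sigma> \<noteq> {} \<and> (\<forall>\<tau>. \<tau> \<subseteq> \<sigma> \<and> \<tau> \<noteq> {} \<longrightarrow> \<tau> \<in> K))"

text \<open>The closed simplex spanned by a finite vertex set, in barycentric coordinates.\<close>

definition closed_simplex :: "'v set \<Rightarrow> ('v \<Rightarrow> real) set" where
  "closed_simplex \<sigma> = {\<alpha>. (\<forall>v. 0 \<le> \<alpha> v) \<and> (\<forall>v. v \<notin> \<sigma> \<longrightarrow> \<alpha> v = 0) \<and> sum \<alpha> \<sigma> = 1}"

text \<open>The geometric realization carries the weak topology: a set is open iff its trace on every
  closed simplex is open there.  For finite \<open>\<sigma>\<close> the pointwise topology on \<open>closed_simplex \<sigma>\<close> is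
  the Euclidean one.\<close>

definition realization_openin :: "'v set set \<Rightarrow> ('v \<Rightarrow> real) set \<Rightarrow> bool" where
  "realization_openin K U \<longleftrightarrow>
     U \<subseteq> \<Union> (closed_simplex ` K) \<and>
     (\<forall>\<sigma>\<in>K. openin (top_of_set (closed_simplex \<sigma>)) (U \<inter> closed_simplex \<sigma>))"

definition realization :: "'v set set \<Rightarrow> ('v \<Rightarrow> real) topology" where
  "realization K = topology (realization_openin K)"

lemma istopology_realization_openin: "istopology (realization_openin K)"
  unfolding istopology_def
proof (intro conjI allI impI)
  fix S T assume "realization_openin K S" "realization_openin K T"
  then have S: "S \<subseteq> \<Union> (closed_simplex ` K)"
      "\<And>\<sigma>. \<sigma> \<in> K \<Longrightarrow> openin (top_of_set (closed_simplex \<sigma>)) (S \<inter> closed_simplex \<sigma>)"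
    and T: "\<And>\<sigma>. \<sigma> \<in> K \<Longrightarrow> openin (top_of_set (closed_simplex \<sigma>)) (T \<inter> closed_simplex \<sigma>)"
    by (auto simp: realization_openin_def)
  have "openin (top_of_set (closed_simplex \<sigma>)) (S \<inter> T \<inter> closed_simplex \<sigma>)" if "\<sigma> \<in> K" for \<sigma>
  proof -
    have "S \<inter> T \<inter> closed_simplex \<sigma> = (S \<inter> closed_simplex \<sigma>) \<inter> (T \<inter> closed_simplex \<sigma>)"
      by blast
    then show ?thesis
      using openin_Int[OF S(2)[OF that] T[OF that]] by (simp only:)
  qed
  with S(1) show "realization_openin K (S \<inter> T)"
    by (auto simp: realization_openin_def)
next
  fix \<K> assume *: "\<forall>S\<in>\<K>. realization_openin K S"
  have "openin (top_of_set (closed_simplex \<sigma>)) (\<Union>\<K> \<inter> closed_simplex \<sigma>)" if "\<sigma> \<in> K" for \<sigma>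
  proof -
    have "\<Union>\<K> \<inter> closed_simplex \<sigma> = (\<Union>S\<in>\<K>. S \<inter> closed_simplex \<sigma>)"
      by blast
    moreover have "openin (top_of_set (closed_simplex \<sigma>)) (\<Union>S\<in>\<K>. S \<inter> closed_simplex \<sigma>)"
      by (rule openin_Union) (use * that in \<open>auto simp: realization_openin_def\<close>)
    ultimately show ?thesis
      by (simp only:)
  qed
  moreover have "\<Union>\<K> \<subseteq> \<Union> (closed_simplex ` K)"
    using * unfolding realization_openin_def by blast
  ultimately show "realization_openin K (\<Union>\<K>)"
    by (simp add: realization_openin_def)
qed

lemma openin_realization: "openin (realization K) = realization_openin K"
  by (simp add: realization_def istopology_realization_openin topology_inverse')

text \<open>Objects of \<open>HPol\<^sub>*\<close>.  The complex has its vertices in the type \<open>'v\<close>, which the argument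
  \<open>TYPE('v)\<close> makes explicit because it does not occur in the type of the space.  The base point of
  a polyhedron may be any of its points.\<close>

definition HPol :: "'v itself \<Rightarrow> 'p pspace \<Rightarrow> bool" where
  "HPol (_ :: 'v itself) A \<longleftrightarrow>
     pointed_space A \<and>
     (\<exists>(K :: 'v set set) x. abstract_simplicial_complex K \<and> x \<in> topspace (realization K) \<and>
        hTop_isomorphic A (realization K, x))"


section \<open>Inverse systems and expansions\<close>

definition directed_set :: "'l set \<Rightarrow> 'l rel \<Rightarrow> bool" where
  "directed_set \<Lambda> r \<longleftrightarrow> \<Lambda> \<noteq> {} \<and> preorder_on \<Lambda> r \<and>
     (\<forall>i\<in>\<Lambda>. \<forall>j\<in>\<Lambda>. \<exists>m\<in>\<Lambda>. (i, m) \<in> r \<and> (j, m) \<in> r)"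

text \<open>\<open>bond S i j\<close> is the bonding morphism from \<open>obj S j\<close> to \<open>obj S i\<close> for \<open>i \<le> j\<close>, the latter meaning
  \<open>(i, j) \<in> idx_le S\<close>.\<close>

record ('l, 'p) inv_sys =
  idx :: "'l set"
  idx_le :: "'l rel"
  obj :: "'l \<Rightarrow> 'p pspace"
  bond :: "'l \<Rightarrow> 'l \<Rightarrow> ('p \<Rightarrow> 'p) set"

definition HPol_inverse_system :: "'v itself \<Rightarrow> ('l, 'p) inv_sys \<Rightarrow> bool" where
  "HPol_inverse_system V S \<longleftrightarrow>
     directed_set (idx S) (idx_le S) \<and>
     (\<forall>i \<in> idx S. HPol V (obj S i)) \<and>
     (\<forall>(i, j) \<in> idx_le S. bond S i j \<in> hTop_hom (obj S j) (obj S i)) \<and>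
     (\<forall>i \<in> idx S. bond S i i = hTop_id (obj S i)) \<and>
     (\<forall>i j m. (i, j) \<in> idx_le S \<and> (j, m) \<in> idx_le S \<longrightarrow>
        hTop_comp (obj S m) (obj S i) (bond S i j) (bond S j m) = bond S i m)"

text \<open>A morphism from a pointed space \<open>A\<close> to the system \<open>S\<close> in the pro-category.\<close>

definition pro_morphism :: "'a pspace \<Rightarrow> ('l, 'p) inv_sys \<Rightarrow> ('l \<Rightarrow> ('a \<Rightarrow> 'p) set) \<Rightarrow> bool" where
  "pro_morphism A S p \<longleftrightarrow>
     (\<forall>i \<in> idx S. p i \<in> hTop_hom A (obj S i)) \<and>
     (\<forall>(i, j) \<in> idx_le S. hTop_comp A (obj S i) (bond S i j) (p j) = p i)"

text \<open>A formula cannot quantify over types, so the test objects \<open>P\<close> range over the same universe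
  (carrier type \<open>'p\<close>, vertex type \<open>'v\<close>) as the members of the system; both types are arbitrary.\<close>

definition HPol_expansion ::
  "'v itself \<Rightarrow> 'a pspace \<Rightarrow> ('l, 'p) inv_sys \<Rightarrow> ('l \<Rightarrow> ('a \<Rightarrow> 'p) set) \<Rightarrow> bool" where
  "HPol_expansion V A S p \<longleftrightarrow>
     HPol_inverse_system V S \<and> pro_morphism A S p \<and>
     (\<forall>P :: 'p pspace. HPol V P \<longrightarrow>
        (\<forall>h \<in> hTop_hom A P. \<exists>i \<in> idx S. \<exists>f \<in> hTop_hom (obj S i) P. hTop_comp A P f (p i) = h)) \<and>
     (\<forall>P :: 'p pspace. HPol V P \<longrightarrow>
        (\<forall>i \<in> idx S. \<forall>f0 \<in> hTop_hom (obj S i) P. \<forall>f1 \<in> hTop_hom (obj S i) P.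
           hTop_comp A P f0 (p i) = hTop_comp A P f1 (p i) \<longrightarrow>
           (\<exists>j. (i, j) \<in> idx_le S \<and>
              hTop_comp (obj S j) P f0 (bond S i j) = hTop_comp (obj S j) P f1 (bond S i j))))"


section \<open>Homotopy groups\<close>

definition sphere_base :: "nat \<Rightarrow> real" where
  "sphere_base = (\<lambda>i. if i = 0 then 1 else 0)"

abbreviation psphere :: "nat \<Rightarrow> (nat \<Rightarrow> real) pspace" where
  "psphere k \<equiv> (nsphere k, sphere_base)"

definition unit_cube :: "nat \<Rightarrow> (nat \<Rightarrow> real) set" where
  "unit_cube k = {t. (\<forall>i<k. 0 \<le> t i \<and> t i \<le> 1) \<and> (\<forall>i\<ge>k. t i = 0)}"

text \<open>A standard identification of the quotient of the cube by its boundary with the sphere: the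
  interior is mapped onto Euclidean space coordinatewise by \<open>s \<mapsto> 1/(1-s) - 1/s\<close> and then onto
  the sphere without its base point by inverse stereographic projection; the boundary goes to the
  base point.\<close>

definition cube_to_sphere :: "nat \<Rightarrow> (nat \<Rightarrow> real) \<Rightarrow> (nat \<Rightarrow> real)" where
  "cube_to_sphere k t =
     (if \<exists>i<k. t i = 0 \<or> t i = 1 then sphere_base
      else let y = (\<lambda>i. 1 / (1 - t i) - 1 / t i); R = (\<Sum>i<k. (y i)\<^sup>2)
           in (\<lambda>i. if i = 0 then (R - 1) / (R + 1)
                   else if i \<le> k then 2 * y (i - 1) / (R + 1) else 0))"

text \<open>Juxtaposition in the first cube coordinate, for maps of the sphere and \<open>k \<ge> 1\<close>.  The choice of
  the preimage \<open>t\<close> matters only over the base point, where every choice gives the base point of the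
  target.\<close>

definition loop_mult :: "nat \<Rightarrow> ((nat \<Rightarrow> real) \<Rightarrow> 'p) \<Rightarrow> ((nat \<Rightarrow> real) \<Rightarrow> 'p) \<Rightarrow> (nat \<Rightarrow> real) \<Rightarrow> 'p" where
  "loop_mult k f g =
     (\<lambda>s \<in> topspace (nsphere k).
        let t = (SOME t. t \<in> unit_cube k \<and> cube_to_sphere k t = s)
        in if t 0 \<le> 1 / 2 then f (cube_to_sphere k (t(0 := 2 * t 0)))
           else g (cube_to_sphere k (t(0 := 2 * t 0 - 1))))"

definition pi_group :: "nat \<Rightarrow> 'p pspace \<Rightarrow> ((nat \<Rightarrow> real) \<Rightarrow> 'p) set monoid" where
  "pi_group k A =
     \<lparr>carrier = hTop_hom (psphere k) A,
      mult = (\<lambda>c d. \<Union>f\<in>c. \<Union>g\<in>d. hclass (psphere k) A (loop_mult k f g)),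
      one = hclass (psphere k) A (\<lambda>s \<in> topspace (nsphere k). snd A)\<rparr>"

definition compact_open :: "'a topology \<Rightarrow> 'b topology \<Rightarrow> ('a \<Rightarrow> 'b) topology" where
  "compact_open X Y =
     topology_generated_by {{f \<in> cmaps X Y. f ` C \<subseteq> U} | C U. compactin X C \<and> openin Y U}"

definition loop_space :: "nat \<Rightarrow> 'p pspace \<Rightarrow> ((nat \<Rightarrow> real) \<Rightarrow> 'p) topology" where
  "loop_space k A = subtopology (compact_open (nsphere k) (fst A)) (pmaps (psphere k) A)"

definition quot_topology :: "'a topology \<Rightarrow> ('a \<Rightarrow> 'b) \<Rightarrow> 'b topology" where
  "quot_topology X f =
     topology (\<lambda>U. U \<subseteq> f ` topspace X \<and> openin X {x \<in> topspace X. f x \<in> U})"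

lemma openin_quot_topology:
  "openin (quot_topology X f) U \<longleftrightarrow> U \<subseteq> f ` topspace X \<and> openin X {x \<in> topspace X. f x \<in> U}"
proof -
  have "istopology (\<lambda>U. U \<subseteq> f ` topspace X \<and> openin X {x \<in> topspace X. f x \<in> U})"
    unfolding istopology_def
  proof (intro conjI allI impI)
    fix S T
    assume "S \<subseteq> f ` topspace X \<and> openin X {x \<in> topspace X. f x \<in> S}"
      and "T \<subseteq> f ` topspace X \<and> openin X {x \<in> topspace X. f x \<in> T}"
    moreover have "{x \<in> topspace X. f x \<in> S \<inter> T} =
        {x \<in> topspace X. f x \<in> S} \<inter> {x \<in> topspace X. f x \<in> T}"
      by blast
    ultimately show "S \<inter> T \<subseteq> f ` topspace X" "openin X {x \<in> topspace X. f x \<in> S \<inter> T}"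
      by auto
  next
    fix \<K> assume *: "\<forall>S\<in>\<K>. S \<subseteq> f ` topspace X \<and> openin X {x \<in> topspace X. f x \<in> S}"
    then show "\<Union>\<K> \<subseteq> f ` topspace X"
      by blast
    have "{x \<in> topspace X. f x \<in> \<Union>\<K>} = (\<Union>S\<in>\<K>. {x \<in> topspace X. f x \<in> S})"
      by blast
    moreover have "openin X (\<Union>S\<in>\<K>. {x \<in> topspace X. f x \<in> S})"
      using * by (intro openin_Union) auto
    ultimately show "openin X {x \<in> topspace X. f x \<in> \<Union>\<K>}"
      by (simp only:)
  qed
  then show ?thesis
    by (simp add: quot_topology_def topology_inverse')
qed

lemma quotient_map_quot_topology: "quotient_map X (quot_topology X f) f"
proof -
  have "{x \<in> topspace X. f x \<in> f ` topspace X} = topspace X"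
    by blast
  then have "openin (quot_topology X f) (f ` topspace X)"
    by (simp add: openin_quot_topology)
  then have "topspace (quot_topology X f) = f ` topspace X"
    by (metis openin_quot_topology openin_subset openin_topspace subset_antisym)
  then show ?thesis
    by (simp add: quotient_map_def openin_quot_topology)
qed

definition pi_qtop :: "nat \<Rightarrow> 'p pspace \<Rightarrow> ((nat \<Rightarrow> real) \<Rightarrow> 'p) set topology" where
  "pi_qtop k A = quot_topology (loop_space k A) (hclass (psphere k) A)"


section \<open>Inverse limits\<close>

definition invlim_carrier ::
  "'l set \<Rightarrow> 'l rel \<Rightarrow> ('l \<Rightarrow> 'c set) \<Rightarrow> ('l \<Rightarrow> 'l \<Rightarrow> 'c \<Rightarrow> 'c) \<Rightarrow> ('l \<Rightarrow> 'c) set" where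
  "invlim_carrier \<Lambda> r C \<phi> = {x \<in> Pi\<^sub>E \<Lambda> C. \<forall>(i, j) \<in> r. \<phi> i j (x j) = x i}"

definition invlim_group ::
  "'l set \<Rightarrow> 'l rel \<Rightarrow> ('l \<Rightarrow> 'c monoid) \<Rightarrow> ('l \<Rightarrow> 'l \<Rightarrow> 'c \<Rightarrow> 'c) \<Rightarrow> ('l \<Rightarrow> 'c) monoid" where
  "invlim_group \<Lambda> r G \<phi> =
     \<lparr>carrier = invlim_carrier \<Lambda> r (\<lambda>i. carrier (G i)) \<phi>,
      mult = (\<lambda>x y. \<lambda>i\<in>\<Lambda>. x i \<otimes>\<^bsub>G i\<^esub> y i),
      one = (\<lambda>i\<in>\<Lambda>. \<one>\<^bsub>G i\<^esub>)\<rparr>"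

definition invlim_topology ::
  "'l set \<Rightarrow> 'l rel \<Rightarrow> ('l \<Rightarrow> 'c topology) \<Rightarrow> ('l \<Rightarrow> 'l \<Rightarrow> 'c \<Rightarrow> 'c) \<Rightarrow> ('l \<Rightarrow> 'c) topology" where
  "invlim_topology \<Lambda> r T \<phi> =
     subtopology (product_topology T \<Lambda>) (invlim_carrier \<Lambda> r (\<lambda>i. topspace (T i)) \<phi>)"

text \<open>The homomorphism of homotopy groups induced by the bonding morphism from \<open>obj S j\<close> to \<open>obj S i\<close>.\<close>

definition pi_bond ::
  "nat \<Rightarrow> ('l, 'p) inv_sys \<Rightarrow> 'l \<Rightarrow> 'l \<Rightarrow> ((nat \<Rightarrow> real) \<Rightarrow> 'p) set \<Rightarrow> ((nat \<Rightarrow> real) \<Rightarrow> 'p) set" where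
  "pi_bond k S i j c = hTop_comp (psphere k) (obj S i) (bond S i j) c"

definition lim_pi_group ::
  "nat \<Rightarrow> ('l, 'p) inv_sys \<Rightarrow> ('l \<Rightarrow> ((nat \<Rightarrow> real) \<Rightarrow> 'p) set) monoid" where
  "lim_pi_group k S = invlim_group (idx S) (idx_le S) (\<lambda>i. pi_group k (obj S i)) (pi_bond k S)"

definition lim_pi_qtop ::
  "nat \<Rightarrow> ('l, 'p) inv_sys \<Rightarrow> ('l \<Rightarrow> ((nat \<Rightarrow> real) \<Rightarrow> 'p) set) topology" where
  "lim_pi_qtop k S = invlim_topology (idx S) (idx_le S) (\<lambda>i. pi_qtop k (obj S i)) (pi_bond k S)"


section \<open>Shape groups\<close>

text \<open>Shape morphisms from \<open>A\<close> to a pointed space, represented by means of the system \<open>S\<close> of an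
  expansion of that space; \<open>F i\<close> is the composite of the \<open>i\<close>-th projection with \<open>F\<close>.\<close>

definition Sh :: "'a pspace \<Rightarrow> ('l, 'p) inv_sys \<Rightarrow> ('l \<Rightarrow> ('a \<Rightarrow> 'p) set) set" where
  "Sh A S =
     {F \<in> Pi\<^sub>E (idx S) (\<lambda>i. hTop_hom A (obj S i)).
        \<forall>(i, j) \<in> idx_le S. hTop_comp A (obj S i) (bond S i j) (F j) = F i}"

definition shape_group ::
  "nat \<Rightarrow> ('l, 'p) inv_sys \<Rightarrow> ('l \<Rightarrow> ((nat \<Rightarrow> real) \<Rightarrow> 'p) set) monoid" where
  "shape_group k S =
     \<lparr>carrier = Sh (psphere k) S,
      mult = (\<lambda>F G. \<lambda>i \<in> idx S. F i \<otimes>\<^bsub>pi_group k (obj S i)\<^esub> G i),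
      one = (\<lambda>i \<in> idx S. \<one>\<^bsub>pi_group k (obj S i)\<^esub>)\<rparr>"

definition shape_nbhd ::
  "nat \<Rightarrow> ('l, 'p) inv_sys \<Rightarrow> 'l \<Rightarrow> ('l \<Rightarrow> ((nat \<Rightarrow> real) \<Rightarrow> 'p) set) \<Rightarrow>
    ('l \<Rightarrow> ((nat \<Rightarrow> real) \<Rightarrow> 'p) set) set" where
  "shape_nbhd k S i F = {G \<in> Sh (psphere k) S. F i = G i}"

definition shape_basis ::
  "nat \<Rightarrow> ('l, 'p) inv_sys \<Rightarrow> ('l \<Rightarrow> ((nat \<Rightarrow> real) \<Rightarrow> 'p) set) set \<Rightarrow> bool" where
  "shape_basis k S V \<longleftrightarrow> (\<exists>i \<in> idx S. \<exists>F \<in> Sh (psphere k) S. V = shape_nbhd k S i F)"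

definition shape_topology ::
  "nat \<Rightarrow> ('l, 'p) inv_sys \<Rightarrow> ('l \<Rightarrow> ((nat \<Rightarrow> real) \<Rightarrow> 'p) set) topology" where
  "shape_topology k S = topology (arbitrary union_of shape_basis k S)"

lemma openin_shape_topology:
  assumes "directed_set (idx S) (idx_le S)"
  shows "openin (shape_topology k S) = arbitrary union_of shape_basis k S"
proof -
  have "(arbitrary union_of shape_basis k S) (V \<inter> W)"
    if V: "shape_basis k S V" and W: "shape_basis k S W" for V W
  proof -
    obtain i F where i: "i \<in> idx S" "V = shape_nbhd k S i F"
      using V by (auto simp: shape_basis_def)
    obtain j G where j: "j \<in> idx S" "W = shape_nbhd k S j G"
      using W by (auto simp: shape_basis_def)
    obtain m where m: "m \<in> idx S" "(i, m) \<in> idx_le S" "(j, m) \<in> idx_le S"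
      using assms i(1) j(1) unfolding directed_set_def by blast
    have sub: "shape_nbhd k S m H \<subseteq> V \<inter> W" if "H \<in> V \<inter> W" for H
    proof
      fix H' assume H': "H' \<in> shape_nbhd k S m H"
      have "H n = H' n" if "(n, m) \<in> idx_le S" for n
        using H' \<open>H \<in> V \<inter> W\<close> that i j unfolding shape_nbhd_def Sh_def by fastforce
      then show "H' \<in> V \<inter> W"
        using H' that m i j by (auto simp: shape_nbhd_def)
    qed
    have "H \<in> shape_nbhd k S m H" "shape_basis k S (shape_nbhd k S m H)" if "H \<in> V \<inter> W" for H
      using that m i by (auto simp: shape_nbhd_def shape_basis_def)
    with sub show ?thesis
      unfolding arbitrary_union_of_alt by blast
  qed
  then show ?thesis
    by (simp add: shape_topology_def istopology_base_eq topology_inverse')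
qed


section \<open>Isomorphism of topological groups\<close>

definition topological_group_isomorphic ::
  "'a monoid \<Rightarrow> 'a topology \<Rightarrow> 'b monoid \<Rightarrow> 'b topology \<Rightarrow> bool" where
  "topological_group_isomorphic G T H U \<longleftrightarrow> (\<exists>\<phi> \<in> iso G H. homeomorphic_map T U \<phi>)"

end

theory Submission
  imports Defs
begin

text \<open>By (E1) and (E2), composition with a factorization of each projection identifies the shape
  morphisms \<open>S\<^sup>k \<rightarrow> X\<close> taken in two expansions, and this identification is a homomorphism because
  composition with a map respects juxtaposition.  Within one expansion, the shape group and the
  inverse limit are the same group of compatible families, so only the topologies remain to be
  compared.  A based map of a compact metric space into a simplicial complex has a compact-open
  neighbourhood inside its homotopy class, so the homotopy groups of polyhedra are discrete in the
  quotient topology.  Hence the inverse limit topology is generated by the sets on which a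
  coordinate is constant, as is the topology of the shape group.\<close>

section \<open>The pointed homotopy category\<close>

text \<open>The shape group is formed from one expansion \<open>R\<close> and the limit from another
  one \<open>S\<close>, because the shape group belongs to the space and not to the system at hand.
  Two obstacles shape the rest. A complex need not be locally finite, so its weak topology can be
  strictly finer than the pointwise one, and a homotopy given by a formula is not continuous merely
  because its coordinates are; compactness of the source confines each map to finitely many
  simplices, where the two topologies agree. The product in \<open>pi_group\<close> is defined on
  the sphere through an arbitrarily chosen preimage in the cube, so nothing about it is continuous
  by construction; \<open>cube_to_sphere\<close> has to be recognised as a quotient map, also after
  multiplication by an interval, before juxtaposition is seen to respect homotopy.\<close>

lemma phomotopic_refl: "f \<in> pmaps A B \<Longrightarrow> phomotopic A B f f"
  by (simp add: phomotopic_def pmaps_def cmaps_def)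

lemma phomotopic_sym: "phomotopic A B f g \<Longrightarrow> phomotopic A B g f"
  by (simp add: phomotopic_def homotopic_with_symD)

lemma phomotopic_trans: "phomotopic A B f g \<Longrightarrow> phomotopic A B g h \<Longrightarrow> phomotopic A B f h"
  unfolding phomotopic_def by (rule homotopic_with_trans)

lemma hclass_self: "f \<in> pmaps A B \<Longrightarrow> f \<in> hclass A B f"
  by (simp add: hclass_def phomotopic_refl)

lemma mem_hclassD: "g \<in> hclass A B f \<Longrightarrow> g \<in> pmaps A B" "g \<in> hclass A B f \<Longrightarrow> phomotopic A B f g"
  by (simp_all add: hclass_def)

lemma hclass_cong: "phomotopic A B f g \<Longrightarrow> hclass A B f = hclass A B g"
  by (auto simp: hclass_def intro: phomotopic_sym phomotopic_trans)

lemma hclass_eq_iff: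
  assumes "g \<in> pmaps A B"
  shows "hclass A B f = hclass A B g \<longleftrightarrow> phomotopic A B f g"
  using assms hclass_cong hclass_self mem_hclassD(2) by metis

lemma hTop_homE:
  assumes "c \<in> hTop_hom A B"
  obtains f where "f \<in> pmaps A B" "c = hclass A B f"
  using assms by (auto simp: hTop_hom_def)

lemma hclass_in_hTop_hom [intro]: "f \<in> pmaps A B \<Longrightarrow> hclass A B f \<in> hTop_hom A B"
  by (auto simp: hTop_hom_def)

lemma pmaps_compose:
  assumes "pointed_space A" "f \<in> pmaps A B" "g \<in> pmaps B C"
  shows "compose (topspace (fst A)) g f \<in> pmaps A C"
proof -
  have "continuous_map (fst A) (fst C) (g \<circ> f)"
    using assms by (auto simp: pmaps_def cmaps_def intro: continuous_map_compose)
  then have "continuous_map (fst A) (fst C) (compose (topspace (fst A)) g f)"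
    by (rule continuous_map_eq) (simp add: compose_def)
  then show ?thesis
    using assms by (auto simp: pmaps_def cmaps_def pointed_space_def compose_def)
qed

lemma phomotopic_eq:
  assumes "pointed_space A" "phomotopic A B f g"
    and "\<And>x. x \<in> topspace (fst A) \<Longrightarrow> f' x = f x" "\<And>x. x \<in> topspace (fst A) \<Longrightarrow> g' x = g x"
  shows "phomotopic A B f' g'"
  using assms(2) unfolding phomotopic_def
  by (rule homotopic_with_eq) (use assms in \<open>auto simp: pointed_space_def\<close>)

lemma phomotopic_compose_left:
  assumes "pointed_space A" "phomotopic A B f f'" "g \<in> pmaps B C"
  shows "phomotopic A C (compose (topspace (fst A)) g f) (compose (topspace (fst A)) g f')"
proof (rule phomotopic_eq[OF assms(1)])
  show "phomotopic A C (g \<circ> f) (g \<circ> f')"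
    using assms(2) unfolding phomotopic_def
    by (rule homotopic_with_compose_continuous_map_left)
       (use assms(3) in \<open>auto simp: pmaps_def cmaps_def\<close>)
qed (auto simp: compose_def)

lemma phomotopic_compose_right:
  assumes "pointed_space A" "f \<in> pmaps A B" "phomotopic B C g g'"
  shows "phomotopic A C (compose (topspace (fst A)) g f) (compose (topspace (fst A)) g' f)"
proof (rule phomotopic_eq[OF assms(1)])
  show "phomotopic A C (g \<circ> f) (g' \<circ> f)"
    using assms(3) unfolding phomotopic_def
    by (rule homotopic_with_compose_continuous_map_right)
       (use assms(2) in \<open>auto simp: pmaps_def cmaps_def\<close>)
qed (auto simp: compose_def)

lemma phomotopic_compose:
  assumes "pointed_space A" "phomotopic A B f f'" "phomotopic B C g g'"
    and "f' \<in> pmaps A B" "g \<in> pmaps B C"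
  shows "phomotopic A C (compose (topspace (fst A)) g f) (compose (topspace (fst A)) g' f')"
  using phomotopic_compose_left[OF assms(1,2,5)] phomotopic_compose_right[OF assms(1,4,3)]
  by (rule phomotopic_trans)

text \<open>The union in \<open>hTop_comp\<close> runs over all pairs of representatives; homotopy
  invariance of composition makes all its members the same class.\<close>

lemma hTop_comp_hclass:
  assumes "pointed_space A" "f \<in> pmaps A B" "g \<in> pmaps B C"
  shows "hTop_comp A C (hclass B C g) (hclass A B f) =
         hclass A C (compose (topspace (fst A)) g f)"
proof -
  have "hclass A C (compose (topspace (fst A)) g' f') = hclass A C (compose (topspace (fst A)) g f)"
    if "f' \<in> hclass A B f" "g' \<in> hclass B C g" for f' g'
  proof -
    have "phomotopic A C (compose (topspace (fst A)) g f) (compose (topspace (fst A)) g' f')"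
      using assms that by (intro phomotopic_compose) (auto dest: mem_hclassD)
    then show ?thesis
      by (rule hclass_cong[symmetric])
  qed
  moreover have "f \<in> hclass A B f" "g \<in> hclass B C g"
    using assms hclass_self by blast+
  ultimately show ?thesis
    unfolding hTop_comp_def by blast
qed

lemma hTop_comp_closed:
  assumes "pointed_space A" "c \<in> hTop_hom A B" "d \<in> hTop_hom B C"
  shows "hTop_comp A C d c \<in> hTop_hom A C"
  using assms by (elim hTop_homE) (simp add: hTop_comp_hclass hclass_in_hTop_hom pmaps_compose)

lemma hTop_comp_assoc:
  assumes "pointed_space A" "pointed_space B"
    and "c \<in> hTop_hom A B" "d \<in> hTop_hom B C" "e \<in> hTop_hom C D"
  shows "hTop_comp A D (hTop_comp B D e d) c = hTop_comp A D e (hTop_comp A C d c)"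
proof -
  obtain f g h where f: "f \<in> pmaps A B" "c = hclass A B f" and g: "g \<in> pmaps B C" "d = hclass B C g"
    and h: "h \<in> pmaps C D" "e = hclass C D h"
    using assms by (elim hTop_homE) blast
  \<comment> \<open>The inner \<open>compose\<close> is undefined off the space of \<open>B\<close>,
    so associativity of the maps themselves needs that \<open>f\<close> lands there.\<close>
  have "f \<in> topspace (fst A) \<rightarrow> topspace (fst B)"
    using f by (auto simp: pmaps_def cmaps_def continuous_map_def)
  then have "compose (topspace (fst A)) (compose (topspace (fst B)) h g) f =
        compose (topspace (fst A)) h (compose (topspace (fst A)) g f)"
    by (auto simp: compose_def fun_eq_iff)
  then show ?thesis
    using assms(1,2) f g h by (simp add: hTop_comp_hclass[of _ _ B] hTop_comp_hclass[of _ _ C] pmaps_compose)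
qed

section \<open>Shape morphisms do not depend on the expansion\<close>

lemma HPol_pointed: "HPol V A \<Longrightarrow> pointed_space A"
  by (simp add: HPol_def)

locale expansion =
  fixes V :: "'v itself" and A :: "'a pspace"
    and S :: "('l, 'p) inv_sys" and p :: "'l \<Rightarrow> ('a \<Rightarrow> 'p) set"
  assumes pointed: "pointed_space A" and expansion: "HPol_expansion V A S p"
begin

lemma system: "HPol_inverse_system V S" and morphism: "pro_morphism A S p"
  using expansion by (auto simp: HPol_expansion_def)

lemma directed: "directed_set (idx S) (idx_le S)"
  using system by (simp add: HPol_inverse_system_def)

lemma idx_le_idx: "(i, j) \<in> idx_le S \<Longrightarrow> i \<in> idx S \<and> j \<in> idx S"
  using directed unfolding directed_set_def preorder_on_def refl_on_def by blast

lemma idx_le_refl: "i \<in> idx S \<Longrightarrow> (i, i) \<in> idx_le S"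
  using directed unfolding directed_set_def preorder_on_def refl_on_def by blast

lemma idx_le_trans: "(i, j) \<in> idx_le S \<Longrightarrow> (j, m) \<in> idx_le S \<Longrightarrow> (i, m) \<in> idx_le S"
  using directed unfolding directed_set_def preorder_on_def by (meson transD)

lemma upper_bound:
  assumes "i \<in> idx S" "j \<in> idx S"
  obtains m where "(i, m) \<in> idx_le S" "(j, m) \<in> idx_le S"
  using directed assms unfolding directed_set_def by blast

lemma HPol_obj: "i \<in> idx S \<Longrightarrow> HPol V (obj S i)"
  using system by (simp add: HPol_inverse_system_def)

lemma pointed_obj: "i \<in> idx S \<Longrightarrow> pointed_space (obj S i)"
  using HPol_obj HPol_pointed by blast

lemma bond_hom: "(i, j) \<in> idx_le S \<Longrightarrow> bond S i j \<in> hTop_hom (obj S j) (obj S i)"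
  using system by (auto simp: HPol_inverse_system_def)

lemma bond_bond:
  assumes "(i, j) \<in> idx_le S" "(j, m) \<in> idx_le S"
  shows "hTop_comp (obj S m) (obj S i) (bond S i j) (bond S j m) = bond S i m"
proof -
  have "\<forall>i j m. (i, j) \<in> idx_le S \<and> (j, m) \<in> idx_le S \<longrightarrow>
      hTop_comp (obj S m) (obj S i) (bond S i j) (bond S j m) = bond S i m"
    using system unfolding HPol_inverse_system_def by (elim conjE)
  from this[rule_format, OF conjI[OF assms]] show ?thesis .
qed

lemma proj_hom: "i \<in> idx S \<Longrightarrow> p i \<in> hTop_hom A (obj S i)"
  using morphism unfolding pro_morphism_def by (elim conjE bspec)

lemma bond_proj:
  assumes "(i, j) \<in> idx_le S"
  shows "hTop_comp A (obj S i) (bond S i j) (p j) = p i"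
proof -
  have "\<forall>(i, j) \<in> idx_le S. hTop_comp A (obj S i) (bond S i j) (p j) = p i"
    using morphism unfolding pro_morphism_def by (rule conjunct2)
  from bspec[OF this assms] show ?thesis
    by (simp only: prod.case)
qed

lemma factor:
  fixes P :: "'p pspace"
  assumes "HPol V P" "h \<in> hTop_hom A P"
  obtains i f where "i \<in> idx S" "f \<in> hTop_hom (obj S i) P" "hTop_comp A P f (p i) = h"
proof -
  have "\<forall>P :: 'p pspace. HPol V P \<longrightarrow>
      (\<forall>h \<in> hTop_hom A P. \<exists>i \<in> idx S. \<exists>f \<in> hTop_hom (obj S i) P. hTop_comp A P f (p i) = h)"
    using expansion unfolding HPol_expansion_def by (elim conjE)
  from this[rule_format, OF assms] show thesis
    by (elim bexE) (rule that)
qed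

lemma factor_unique:
  fixes P :: "'p pspace"
  assumes "HPol V P" "i \<in> idx S" "f0 \<in> hTop_hom (obj S i) P" "f1 \<in> hTop_hom (obj S i) P"
    and "hTop_comp A P f0 (p i) = hTop_comp A P f1 (p i)"
  obtains j where "(i, j) \<in> idx_le S"
    "hTop_comp (obj S j) P f0 (bond S i j) = hTop_comp (obj S j) P f1 (bond S i j)"
proof -
  have "\<forall>P :: 'p pspace. HPol V P \<longrightarrow>
      (\<forall>i \<in> idx S. \<forall>f0 \<in> hTop_hom (obj S i) P. \<forall>f1 \<in> hTop_hom (obj S i) P.
         hTop_comp A P f0 (p i) = hTop_comp A P f1 (p i) \<longrightarrow>
         (\<exists>j. (i, j) \<in> idx_le S \<and>
            hTop_comp (obj S j) P f0 (bond S i j) = hTop_comp (obj S j) P f1 (bond S i j)))"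
    using expansion unfolding HPol_expansion_def by (elim conjE)
  from this[rule_format, OF assms] show thesis
    by (elim exE conjE) (rule that)
qed

lemma Sh_hom: "F \<in> Sh B S \<Longrightarrow> i \<in> idx S \<Longrightarrow> F i \<in> hTop_hom B (obj S i)"
  by (auto simp: Sh_def)

lemma Sh_bond:
  assumes "F \<in> Sh B S" "(i, j) \<in> idx_le S"
  shows "hTop_comp B (obj S i) (bond S i j) (F j) = F i"
proof -
  have "\<forall>(i, j) \<in> idx_le S. hTop_comp B (obj S i) (bond S i j) (F j) = F i"
    using assms(1) unfolding Sh_def by blast
  from bspec[OF this assms(2)] show ?thesis
    by (simp only: prod.case)
qed

text \<open>A class \<open>A \<rightarrow> P\<close> acts on shape morphisms through any of its factorizations over the system.\<close>

lemma factor_Sh_unique: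
  fixes P :: "'p pspace"
  assumes P: "HPol V P" and B: "pointed_space B" and F: "F \<in> Sh B S"
    and i: "i \<in> idx S" "f \<in> hTop_hom (obj S i) P" and j: "j \<in> idx S" "g \<in> hTop_hom (obj S j) P"
    and eq: "hTop_comp A P f (p i) = hTop_comp A P g (p j)"
  shows "hTop_comp B P f (F i) = hTop_comp B P g (F j)"
proof -
  obtain m where m: "(i, m) \<in> idx_le S" "(j, m) \<in> idx_le S"
    using i j upper_bound by blast
  have m': "m \<in> idx S" using idx_le_idx m by blast
  let ?f = "hTop_comp (obj S m) P f (bond S i m)" and ?g = "hTop_comp (obj S m) P g (bond S j m)"
  have f: "?f \<in> hTop_hom (obj S m) P" and g: "?g \<in> hTop_hom (obj S m) P"
    using bond_hom m i j hTop_comp_closed m' pointed_obj by blast+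
  have "hTop_comp A P ?f (p m) = hTop_comp A P f (p i)"
    using hTop_comp_assoc[OF pointed pointed_obj[OF m'] proj_hom[OF m'] bond_hom[OF m(1)] i(2)]
      bond_proj[OF m(1)] by simp
  moreover have "hTop_comp A P ?g (p m) = hTop_comp A P g (p j)"
    using hTop_comp_assoc[OF pointed pointed_obj[OF m'] proj_hom[OF m'] bond_hom[OF m(2)] j(2)]
      bond_proj[OF m(2)] by simp
  \<comment> \<open>(E2) wants both maps to start at one index, hence the passage to
    \<open>m\<close>; equality itself is reached only further out, at \<open>n\<close>.\<close>
  ultimately obtain n where n: "(m, n) \<in> idx_le S"
    "hTop_comp (obj S n) P ?f (bond S m n) = hTop_comp (obj S n) P ?g (bond S m n)"
    using factor_unique[OF P m' f g] eq by metis
  have n': "n \<in> idx S" using idx_le_idx n by blast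
  \<comment> \<open>Compatibility of \<open>F\<close> cancels both bonds, so agreement at
    \<open>n\<close> descends to the values of \<open>F\<close> at the original indices.\<close>
  have *: "hTop_comp B P (hTop_comp (obj S n) P (hTop_comp (obj S m) P h (bond S l m)) (bond S m n)) (F n)
        = hTop_comp B P h (F l)" if l: "(l, m) \<in> idx_le S" and h: "h \<in> hTop_hom (obj S l) P" for h l
  proof -
    have "hTop_comp (obj S n) P (hTop_comp (obj S m) P h (bond S l m)) (bond S m n) =
      hTop_comp (obj S n) P h (bond S l n)"
      using hTop_comp_assoc[OF pointed_obj[OF n'] pointed_obj[OF m'] bond_hom[OF n(1)] bond_hom[OF l] h]
        bond_bond[OF l n(1)] by simp
    moreover have ln: "(l, n) \<in> idx_le S" using idx_le_trans l n(1) by blast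
    ultimately show ?thesis
      using hTop_comp_assoc[OF B pointed_obj[OF n'] Sh_hom[OF F n'] bond_hom[OF ln] h] Sh_bond[OF F ln]
      by simp
  qed
  show ?thesis
    using *[OF m(1) i(2)] *[OF m(2) j(2)] n(2) by simp
qed

end

section \<open>Comparison of two expansions of one space\<close>

locale two_expansions = E: expansion V A R q + D: expansion V A S p
  for V :: "'v itself" and A :: "'a pspace"
    and R :: "('m, 'p) inv_sys" and q :: "'m \<Rightarrow> ('a \<Rightarrow> 'p) set"
    and S :: "('l, 'p) inv_sys" and p :: "'l \<Rightarrow> ('a \<Rightarrow> 'p) set"
begin

text \<open>Index and map are chosen as one pair because (E1) provides them together. The choice is
  arbitrary; \<open>transfer_eq\<close> shows that it has no effect on shape morphisms.\<close>

definition factorization :: "'l \<Rightarrow> 'm \<times> ('p \<Rightarrow> 'p) set" where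
  "factorization i = (SOME x. fst x \<in> idx R \<and> snd x \<in> hTop_hom (obj R (fst x)) (obj S i) \<and>
      hTop_comp A (obj S i) (snd x) (q (fst x)) = p i)"

abbreviation "fac_idx i \<equiv> fst (factorization i)"
abbreviation "fac_map i \<equiv> snd (factorization i)"

definition transfer :: "'b pspace \<Rightarrow> ('m \<Rightarrow> ('b \<Rightarrow> 'p) set) \<Rightarrow> 'l \<Rightarrow> ('b \<Rightarrow> 'p) set" where
  "transfer B F = (\<lambda>i\<in>idx S. hTop_comp B (obj S i) (fac_map i) (F (fac_idx i)))"

lemma factorization:
  assumes "i \<in> idx S"
  shows "fac_idx i \<in> idx R" "fac_map i \<in> hTop_hom (obj R (fac_idx i)) (obj S i)"
    "hTop_comp A (obj S i) (fac_map i) (q (fac_idx i)) = p i"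
proof -
  obtain j f where "j \<in> idx R" "f \<in> hTop_hom (obj R j) (obj S i)" "hTop_comp A (obj S i) f (q j) = p i"
    using E.factor[OF D.HPol_obj[OF assms] D.proj_hom[OF assms]] by blast
  then have "\<exists>x. fst x \<in> idx R \<and> snd x \<in> hTop_hom (obj R (fst x)) (obj S i) \<and>
      hTop_comp A (obj S i) (snd x) (q (fst x)) = p i"
    by (intro exI[of _ "(j, f)"]) simp
  from someI_ex[OF this] show "fac_idx i \<in> idx R"
      "fac_map i \<in> hTop_hom (obj R (fac_idx i)) (obj S i)"
      "hTop_comp A (obj S i) (fac_map i) (q (fac_idx i)) = p i"
    unfolding factorization_def by blast+
qed

text \<open>Frees \<open>transfer\<close> from the choice made in \<open>factorization\<close>: the
  chosen factorization and \<open>f\<close> represent the same class \<open>p i\<close>, so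
  \<open>factor_Sh_unique\<close> applies.\<close>

lemma transfer_eq:
  assumes "pointed_space B" "F \<in> Sh B R" "i \<in> idx S" "j \<in> idx R" "f \<in> hTop_hom (obj R j) (obj S i)"
    and "hTop_comp A (obj S i) f (q j) = p i"
  shows "transfer B F i = hTop_comp B (obj S i) f (F j)"
proof -
  have "hTop_comp A (obj S i) (fac_map i) (q (fac_idx i)) = hTop_comp A (obj S i) f (q j)"
    using factorization(3)[OF assms(3)] assms(6) by (rule trans[OF _ sym])
  from E.factor_Sh_unique[OF D.HPol_obj[OF assms(3)] assms(1,2) factorization(1,2)[OF assms(3)]
      assms(4,5) this]
  show ?thesis
    unfolding transfer_def restrict_apply'[OF assms(3)] .
qed

lemma transfer_in_Sh:
  assumes B: "pointed_space B" and F: "F \<in> Sh B R"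
  shows "transfer B F \<in> Sh B S"
proof -
  have hom: "transfer B F i \<in> hTop_hom B (obj S i)" if "i \<in> idx S" for i
    using hTop_comp_closed[OF B E.Sh_hom[OF F factorization(1)[OF that]] factorization(2)[OF that]] that
    by (simp add: transfer_def)
  have "hTop_comp B (obj S i) (bond S i i') (transfer B F i') = transfer B F i"
    if le: "(i, i') \<in> idx_le S" for i i'
  proof -
    have i: "i \<in> idx S" "i' \<in> idx S" using D.idx_le_idx le by auto
    let ?j = "fac_idx i'" and ?f = "fac_map i'"
    note f = factorization[OF i(2)]
    note bf = hTop_comp_closed[OF E.pointed_obj[OF f(1)] f(2) D.bond_hom[OF le]]
    \<comment> \<open>The bond after the factorization chosen for \<open>i'\<close> is a second
      factorization of \<open>p i\<close>, in general not the one chosen for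
      \<open>i\<close>.\<close>
    have "hTop_comp A (obj S i) (hTop_comp (obj R ?j) (obj S i) (bond S i i') ?f) (q ?j) = p i"
      using hTop_comp_assoc[OF E.pointed E.pointed_obj[OF f(1)] E.proj_hom[OF f(1)] f(2) D.bond_hom[OF le]]
        f(3) D.bond_proj[OF le] by simp
    from transfer_eq[OF B F i(1) f(1) bf this]
    show ?thesis
      using hTop_comp_assoc[OF B E.pointed_obj[OF f(1)] E.Sh_hom[OF F f(1)] f(2) D.bond_hom[OF le]] i(2)
      by (simp add: transfer_def)
  qed
  moreover have "transfer B F \<in> extensional (idx S)"
    by (simp add: transfer_def)
  ultimately show ?thesis
    using hom unfolding Sh_def PiE_def by blast
qed

end

text \<open>Stated outside the locale because the inverse is the same construction with the two
  expansions interchanged. The round trip acts at \<open>j\<close> through a factorization of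
  \<open>q j\<close> over \<open>R\<close> itself, and the identity bond \<open>bond R j j\<close>
  is another such factorization.\<close>

lemma transfer_inverse:
  assumes RS: "two_expansions V A R q S p" and SR: "two_expansions V A S p R q"
    and B: "pointed_space B" and F: "F \<in> Sh B R"
  shows "two_expansions.transfer A S p R q B (two_expansions.transfer A R q S p B F) = F"
proof -
  interpret RS: two_expansions V A R q S p by (rule RS)
  interpret SR: two_expansions V A S p R q by (rule SR)
  let ?G = "RS.transfer B F"
  have "SR.transfer B ?G j = F j" if j: "j \<in> idx R" for j
  proof -
    let ?i = "SR.fac_idx j" and ?g = "SR.fac_map j"
    note g = SR.factorization[OF j]
    let ?l = "RS.fac_idx ?i" and ?f = "RS.fac_map ?i"
    note f = RS.factorization[OF g(1)]
    note gf = hTop_comp_closed[OF RS.E.pointed_obj[OF f(1)] f(2) g(2)]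
    note jj = RS.E.idx_le_refl[OF j]
    have "hTop_comp A (obj R j) (hTop_comp (obj R ?l) (obj R j) ?g ?f) (q ?l) = q j"
      using hTop_comp_assoc[OF RS.E.pointed RS.E.pointed_obj[OF f(1)] RS.E.proj_hom[OF f(1)] f(2) g(2)]
        f(3) g(3) by simp
    then have "hTop_comp B (obj R j) (hTop_comp (obj R ?l) (obj R j) ?g ?f) (F ?l) =
        hTop_comp B (obj R j) (bond R j j) (F j)"
      using RS.E.bond_proj[OF jj]
      by (intro RS.E.factor_Sh_unique[OF RS.E.HPol_obj[OF j] B F f(1) gf j RS.E.bond_hom[OF jj]]) simp
    then have "hTop_comp B (obj R j) ?g (hTop_comp B (obj S ?i) ?f (F ?l)) = F j"
      using hTop_comp_assoc[OF B RS.E.pointed_obj[OF f(1)] RS.E.Sh_hom[OF F f(1)] f(2) g(2)]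
        RS.E.Sh_bond[OF F jj] by simp
    then show ?thesis
      using j g(1) by (simp add: SR.transfer_def RS.transfer_def)
  qed
  moreover have "SR.transfer B ?G \<in> extensional (idx R)" "F \<in> extensional (idx R)"
    using F by (auto simp: SR.transfer_def Sh_def PiE_def)
  ultimately show ?thesis
    by (rule extensionalityI[rotated 2])
qed

lemma bij_betw_transfer:
  assumes RS: "two_expansions V A R q S p" and SR: "two_expansions V A S p R q"
    and B: "pointed_space B"
  shows "bij_betw (two_expansions.transfer A R q S p B) (Sh B R) (Sh B S)"
proof (rule bij_betw_byWitness)
  show "\<forall>F\<in>Sh B R. two_expansions.transfer A S p R q B (two_expansions.transfer A R q S p B F) = F"
    using transfer_inverse[OF RS SR B] by blast
  show "\<forall>F\<in>Sh B S. two_expansions.transfer A R q S p B (two_expansions.transfer A S p R q B F) = F"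
    using transfer_inverse[OF SR RS B] by blast
  show "two_expansions.transfer A R q S p B ` Sh B R \<subseteq> Sh B S"
    using two_expansions.transfer_in_Sh[OF RS B] by (rule image_subsetI)
  show "two_expansions.transfer A S p R q B ` Sh B S \<subseteq> Sh B R"
    using two_expansions.transfer_in_Sh[OF SR B] by (rule image_subsetI)
qed

section \<open>Compact subsets of a polyhedron\<close>

abbreviation supp :: "('v \<Rightarrow> real) \<Rightarrow> 'v set" where
  "supp \<alpha> \<equiv> {v. \<alpha> v \<noteq> 0}"

text \<open>Since a simplex is closed in the space of all functions, relative closedness in it
  becomes plain closedness, which is how \<open>closedin_realization\<close> is phrased.\<close>

lemma closed_closed_simplex: "closed (closed_simplex \<sigma>)"
proof -
  have coord: "continuous_on UNIV (\<lambda>\<alpha> :: 'a \<Rightarrow> real. \<alpha> v)" for v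
    by simp
  have "closed_simplex \<sigma> = (\<Inter>v. {\<alpha>. 0 \<le> \<alpha> v}) \<inter> (\<Inter>v\<in>-\<sigma>. {\<alpha>. \<alpha> v = 0}) \<inter> {\<alpha>. (\<Sum>v\<in>\<sigma>. \<alpha> v) = 1}"
    by (auto simp: closed_simplex_def)
  moreover have "closed \<dots>"
    by (intro closed_Int closed_INT ballI closed_Collect_le closed_Collect_eq continuous_on_sum
        continuous_on_const coord)
  ultimately show ?thesis
    by simp
qed

lemma closed_singleton_fun: "closed {x :: 'v \<Rightarrow> real}"
proof -
  have "{x} = (\<Inter>v. {\<alpha>. \<alpha> v = x v})"
    by auto
  moreover have "closed \<dots>"
    by (intro closed_INT ballI closed_Collect_eq continuous_on_const) simp
  ultimately show ?thesis
    by simp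
qed

lemma closed_finite_fun: "finite T \<Longrightarrow> closed (T :: ('v \<Rightarrow> real) set)"
proof -
  assume "finite T"
  then have "closed (\<Union>x\<in>T. {x})"
    by (intro closed_UN ballI closed_singleton_fun)
  then show "closed T"
    by simp
qed

lemma topspace_realization: "topspace (realization K) = \<Union> (closed_simplex ` K)"
proof
  show "topspace (realization K) \<subseteq> \<Union> (closed_simplex ` K)"
    using openin_topspace[of "realization K"] by (simp add: openin_realization realization_openin_def)
  have "\<Union> (closed_simplex ` K) \<inter> closed_simplex \<sigma> = closed_simplex \<sigma>" if "\<sigma> \<in> K" for \<sigma>
    using that by blast
  then have "openin (realization K) (\<Union> (closed_simplex ` K))"
    by (simp add: openin_realization realization_openin_def)
  then show "\<Union> (closed_simplex ` K) \<subseteq> topspace (realization K)"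
    by (rule openin_subset)
qed

lemma closedin_realization:
  "closedin (realization K) C \<longleftrightarrow>
     C \<subseteq> \<Union> (closed_simplex ` K) \<and> (\<forall>\<sigma>\<in>K. closed (C \<inter> closed_simplex \<sigma>))"
proof -
  have "openin (top_of_set (closed_simplex \<sigma>)) ((\<Union> (closed_simplex ` K) - C) \<inter> closed_simplex \<sigma>) \<longleftrightarrow>
        closed (C \<inter> closed_simplex \<sigma>)" if "\<sigma> \<in> K" for \<sigma>
  proof -
    have "(\<Union> (closed_simplex ` K) - C) \<inter> closed_simplex \<sigma> = closed_simplex \<sigma> - C \<inter> closed_simplex \<sigma>"
      using that by blast
    then show ?thesis
      using closedin_closed_eq[OF closed_closed_simplex, of \<sigma> "C \<inter> closed_simplex \<sigma>"]
      by (simp add: closedin_def)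
  qed
  then show ?thesis
    unfolding closedin_def topspace_realization openin_realization realization_openin_def by blast
qed

text \<open>Coordinates have the same sum over every finite vertex set that contains the support, so
  membership depends on the support and not on the surrounding simplex.\<close>

lemma closed_simplexI:
  assumes "\<alpha> \<in> closed_simplex \<sigma>" "finite \<sigma>" "supp \<alpha> \<subseteq> \<tau>" "finite \<tau>"
  shows "\<alpha> \<in> closed_simplex \<tau>"
proof -
  have "sum \<alpha> \<tau> = sum \<alpha> (supp \<alpha>)"
    using assms by (intro sum.mono_neutral_right) auto
  also have "\<dots> = sum \<alpha> \<sigma>"
    using assms by (intro sum.mono_neutral_left) (auto simp: closed_simplex_def)
  finally show ?thesis
    using assms by (auto simp: closed_simplex_def)
qed

lemma supp_subset: "\<alpha> \<in> closed_simplex \<sigma> \<Longrightarrow> supp \<alpha> \<subseteq> \<sigma>"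
  by (auto simp: closed_simplex_def)

lemma closed_simplex_mono:
  assumes "\<sigma> \<subseteq> \<tau>" "finite \<tau>"
  shows "closed_simplex \<sigma> \<subseteq> closed_simplex \<tau>"
proof
  fix \<alpha> assume \<alpha>: "\<alpha> \<in> closed_simplex \<sigma>"
  then have "supp \<alpha> \<subseteq> \<tau>"
    using supp_subset assms(1) by blast
  with \<alpha> show "\<alpha> \<in> closed_simplex \<tau>"
    using closed_simplexI[OF _ finite_subset[OF assms] _ assms(2)] by simp
qed

text \<open>The support is the carrier of the point: a face of any simplex containing it, and
  nonempty because the coordinates sum to 1.\<close>

lemma supp_simplex:
  assumes K: "abstract_simplicial_complex K" and \<alpha>: "\<alpha> \<in> topspace (realization K)"
  shows "supp \<alpha> \<in> K" "finite (supp \<alpha>)" "\<alpha> \<in> closed_simplex (supp \<alpha>)"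
proof -
  obtain \<sigma> where \<sigma>: "\<sigma> \<in> K" "\<alpha> \<in> closed_simplex \<sigma>"
    using \<alpha> by (auto simp: topspace_realization)
  have fin: "finite \<sigma>"
    using K \<sigma>(1) by (simp add: abstract_simplicial_complex_def)
  show fins: "finite (supp \<alpha>)"
    using supp_subset[OF \<sigma>(2)] fin by (rule finite_subset)
  show mem: "\<alpha> \<in> closed_simplex (supp \<alpha>)"
    using \<sigma>(2) fin _ fins by (rule closed_simplexI) simp
  have "supp \<alpha> \<noteq> {}"
  proof
    assume "supp \<alpha> = {}"
    with mem show False
      by (simp add: closed_simplex_def)
  qed
  then show "supp \<alpha> \<in> K"
    using K \<sigma>(1) supp_subset[OF \<sigma>(2)] unfolding abstract_simplicial_complex_def by blast
qed

text \<open>Choose one point of \<open>C\<close> for each support that occurs. A simplex has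
  finitely many faces, so any set of chosen points meets it in a finite set and is therefore closed.
  Thus the chosen points have no accumulation point, and a compact set holds only finitely many of
  them.\<close>

lemma compactin_realization_finite:
  assumes K: "abstract_simplicial_complex K" and C: "compactin (realization K) C"
  obtains F where "finite F" "F \<subseteq> K" "C \<subseteq> \<Union> (closed_simplex ` F)"
proof -
  have Ctop: "C \<subseteq> topspace (realization K)"
    using C by (rule compactin_subset_topspace)
  have "\<forall>s\<in>supp ` C. \<exists>\<alpha>. \<alpha> \<in> C \<and> supp \<alpha> = s"
    by blast
  then obtain r where r: "\<And>s. s \<in> supp ` C \<Longrightarrow> r s \<in> C \<and> supp (r s) = s"
    by metis
  let ?T = "r ` (supp ` C)"
  have TC: "?T \<subseteq> C"
    using r by blast
  have closedin: "closedin (realization K) T'" if T': "T' \<subseteq> ?T" for T'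
  proof -
    have "finite (T' \<inter> closed_simplex \<sigma>)" if "\<sigma> \<in> K" for \<sigma>
    proof (rule finite_subset)
      show "finite (r ` Pow \<sigma>)"
        using K that by (simp add: abstract_simplicial_complex_def)
      show "T' \<inter> closed_simplex \<sigma> \<subseteq> r ` Pow \<sigma>"
      proof
        fix \<alpha> assume \<alpha>: "\<alpha> \<in> T' \<inter> closed_simplex \<sigma>"
        then obtain s where s: "s \<in> supp ` C" "\<alpha> = r s"
          using T' by blast
        then have "s \<subseteq> \<sigma>"
          using supp_subset[of \<alpha> \<sigma>] \<alpha> r[OF s(1)] by simp
        then show "\<alpha> \<in> r ` Pow \<sigma>"
          using s(2) by blast
      qed
    qed
    moreover have "T' \<subseteq> \<Union> (closed_simplex ` K)"
      using T' TC Ctop unfolding topspace_realization by blast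
    ultimately show ?thesis
      unfolding closedin_realization by (simp add: closed_finite_fun)
  qed
  have "finite ?T"
  proof (rule ccontr)
    assume "infinite ?T"
    then obtain x where "x \<in> realization K derived_set_of ?T"
      using compactin_imp_Bolzano_Weierstrass[OF C] TC by blast
    then have x: "x \<in> topspace (realization K)"
        "\<And>U. x \<in> U \<Longrightarrow> openin (realization K) U \<Longrightarrow> \<exists>y. y \<noteq> x \<and> y \<in> ?T \<and> y \<in> U"
      unfolding in_derived_set_of by blast+
    have "closedin (realization K) (?T - {x})"
      by (rule closedin) blast
    then have "openin (realization K) (topspace (realization K) - (?T - {x}))"
      by (simp add: openin_diff)
    from x(2)[OF _ this] x(1) show False
      by blast
  qed
  moreover have "inj_on r (supp ` C)"
    using r by (intro inj_on_inverseI[of _ supp]) simp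
  ultimately have "finite (supp ` C)"
    by (metis finite_imageD)
  moreover have "supp ` C \<subseteq> K"
    using supp_simplex(1)[OF K] Ctop by blast
  moreover have "C \<subseteq> \<Union> (closed_simplex ` supp ` C)"
    using supp_simplex(3)[OF K] Ctop by blast
  ultimately show thesis
    by (rule that)
qed

text \<open>A closed set of the realization meets a finite union of simplices in a finite union of
  closed sets, so there the weak topology is no finer than the pointwise one.\<close>

lemma continuous_map_into_realization:
  assumes "finite F" "F \<subseteq> K" "continuous_map Z euclidean H"
    and H: "\<And>z. z \<in> topspace Z \<Longrightarrow> H z \<in> \<Union> (closed_simplex ` F)"
  shows "continuous_map Z (realization K) H"
  unfolding continuous_map_closedin
proof (intro conjI allI impI)
  show "H \<in> topspace Z \<rightarrow> topspace (realization K)"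
    using H assms(2) unfolding topspace_realization by blast
  fix C assume "closedin (realization K) C"
  then have "closed (C \<inter> closed_simplex \<sigma>)" if "\<sigma> \<in> F" for \<sigma>
    using that assms(2) by (auto simp: closedin_realization)
  then have "closed (\<Union>\<sigma>\<in>F. C \<inter> closed_simplex \<sigma>)"
    using assms(1) by (intro closed_UN) auto
  then have "closedin Z {z \<in> topspace Z. H z \<in> (\<Union>\<sigma>\<in>F. C \<inter> closed_simplex \<sigma>)}"
    using assms(3) by (intro closedin_continuous_map_preimage) auto
  moreover have "{z \<in> topspace Z. H z \<in> (\<Union>\<sigma>\<in>F. C \<inter> closed_simplex \<sigma>)} = {z \<in> topspace Z. H z \<in> C}"
    using H by blast
  ultimately show "closedin Z {z \<in> topspace Z. H z \<in> C}"
    by simp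
qed

lemma continuous_map_realization_euclidean: "continuous_map (realization K) euclidean (\<lambda>\<alpha>. \<alpha>)"
  unfolding continuous_map_closedin
proof (intro conjI allI impI)
  fix C :: "('a \<Rightarrow> real) set" assume "closedin euclidean C"
  then have "closed (C \<inter> closed_simplex \<sigma>)" for \<sigma>
    using closed_closed_simplex by (intro closed_Int) simp_all
  moreover have "{\<alpha> \<in> \<Union> (closed_simplex ` K). \<alpha> \<in> C} \<inter> closed_simplex \<sigma> = C \<inter> closed_simplex \<sigma>"
    if "\<sigma> \<in> K" for \<sigma>
    using that by blast
  ultimately show "closedin (realization K) {\<alpha> \<in> topspace (realization K). \<alpha> \<in> C}"
    unfolding closedin_realization topspace_realization by auto
qed simp

definition open_star :: "'v set set \<Rightarrow> ('v \<Rightarrow> real) \<Rightarrow> ('v \<Rightarrow> real) set" where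
  "open_star K x = {\<alpha> \<in> topspace (realization K). supp x \<subseteq> supp \<alpha>}"

text \<open>Only finitely many coordinates have to be nonzero, which is an open condition already in
  the pointwise topology.\<close>

lemma openin_open_star:
  fixes x :: "'v \<Rightarrow> real"
  assumes "finite (supp x)"
  shows "openin (realization K) (open_star K x)"
proof -
  have "open {\<alpha> :: 'v \<Rightarrow> real. \<alpha> v \<noteq> 0}" for v
    by (intro open_Collect_neq continuous_on_const) simp
  then have "open (\<Inter>v\<in>supp x. {\<alpha> :: 'v \<Rightarrow> real. \<alpha> v \<noteq> 0})"
    using assms by (intro open_INT) blast+
  then have "openin (realization K) {\<alpha> \<in> topspace (realization K). \<alpha> \<in> (\<Inter>v\<in>supp x. {\<alpha>. \<alpha> v \<noteq> 0})}"
    using continuous_map_realization_euclidean by (intro openin_continuous_map_preimage) auto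
  moreover have "{\<alpha> \<in> topspace (realization K). \<alpha> \<in> (\<Inter>v\<in>supp x. {\<alpha>. \<alpha> v \<noteq> 0})} = open_star K x"
    by (auto simp: open_star_def)
  ultimately show ?thesis
    by simp
qed

section \<open>Homotopy groups of polyhedra are discrete\<close>

lemma topspace_compact_open: "topspace (compact_open X Y) = cmaps X Y"
proof -
  \<comment> \<open>With \<open>C\<close> and \<open>U\<close> empty the condition is void, so the
    whole of \<open>cmaps X Y\<close> is a subbasic set.\<close>
  have "{f \<in> cmaps X Y. f ` {} \<subseteq> {}} \<in> {{f \<in> cmaps X Y. f ` C \<subseteq> U} | C U. compactin X C \<and> openin Y U}"
    by blast
  then show ?thesis
    unfolding compact_open_def topology_generated_by_topspace by auto
qed

lemma openin_compact_open:
  assumes "compactin X C" "openin Y U"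
  shows "openin (compact_open X Y) {f \<in> cmaps X Y. f ` C \<subseteq> U}"
  unfolding compact_open_def by (rule topology_generated_by_Basis) (use assms in blast)

lemma continuous_map_compact_open_compose:
  assumes g: "continuous_map Y Z g"
  shows "continuous_map (compact_open X Y) (compact_open X Z) (compose (topspace X) g)"
proof -
  have closed: "compose (topspace X) g f \<in> cmaps X Z" if "f \<in> cmaps X Y" for f
  proof -
    have "continuous_map X Z (g \<circ> f)"
      using that g by (auto simp: cmaps_def intro: continuous_map_compose)
    then have "continuous_map X Z (compose (topspace X) g f)"
      by (rule continuous_map_eq) (simp add: compose_def)
    then show ?thesis
      by (simp add: cmaps_def)
  qed
  have preimage: "openin (compact_open X Y)
      (compose (topspace X) g -` {f \<in> cmaps X Z. f ` C \<subseteq> U} \<inter> topspace (compact_open X Y))"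
    if C: "compactin X C" and U: "openin Z U" for C U
  proof -
    have sub: "C \<subseteq> topspace X"
      using C by (rule compactin_subset_topspace)
    have "f ` C \<subseteq> topspace Y" if "f \<in> cmaps X Y" for f
      using that sub by (auto simp: cmaps_def continuous_map_def)
    then have "compose (topspace X) g -` {f \<in> cmaps X Z. f ` C \<subseteq> U} \<inter> topspace (compact_open X Y) =
        {f \<in> cmaps X Y. f ` C \<subseteq> {y \<in> topspace Y. g y \<in> U}}"
      using closed sub by (auto simp: topspace_compact_open compose_def subset_iff)
    then show ?thesis
      using openin_compact_open[OF C openin_continuous_map_preimage[OF g U]] by simp
  qed
  have "compose (topspace X) g ` topspace (compact_open X Y) \<subseteq> topspace (compact_open X Z)"
    using closed by (auto simp: topspace_compact_open)
  then show ?thesis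
    using preimage unfolding compact_open_def[of X Z] topology_generated_by_topspace
    by (intro continuous_on_generated_topo) blast+
qed

text \<open>Near \<open>f\<close>, every map is joined by straight segments to the same map \<open>h\<close>, a partition of unity
  with centres in \<open>J\<close> averaging the values of \<open>f\<close>: for \<open>t\<close> near a centre \<open>s\<close>, the value \<open>g t\<close> stays in
  the open star of \<open>f s\<close>, so \<open>h t\<close> lies in the closed simplex that carries \<open>g t\<close>.  The supports of the
  bump functions avoid the base point, except for the one centred there.\<close>

lemma phomotopic_nearby:
  fixes T :: "'m::metric_space set"
  assumes K: "abstract_simplicial_complex K" and T: "compact T" "b \<in> T"
    and f: "f \<in> pmaps (top_of_set T, b) (realization K, x)"
  obtains W where "openin (compact_open (top_of_set T) (realization K)) W" "f \<in> W"
    "\<And>g. g \<in> W \<Longrightarrow> g \<in> pmaps (top_of_set T, b) (realization K, x) \<Longrightarrow>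
      phomotopic (top_of_set T, b) (realization K, x) f g"
proof -
  let ?R = "realization K"
  have fc: "continuous_map (top_of_set T) ?R f" and fext: "f \<in> cmaps (top_of_set T) ?R" and fb: "f b = x"
    using f by (auto simp: pmaps_def cmaps_def)
  have fR: "f t \<in> topspace ?R" if "t \<in> T" for t
    using fc that by (auto simp: continuous_map_def)
  \<comment> \<open>The condition is imposed on the closed ball, since its trace on \<open>T\<close>
    has to be compact for use in \<open>W\<close>; the bound by \<open>dist s b\<close> keeps the
    open ball around any other centre away from \<open>b\<close>.\<close>
  have "\<exists>r>0. (\<forall>t\<in>T. dist s t \<le> r \<longrightarrow> f t \<in> open_star K (f s)) \<and> (s \<noteq> b \<longrightarrow> r \<le> dist s b)"
    if s: "s \<in> T" for s
  proof -
    have "openin ?R (open_star K (f s))"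
      by (rule openin_open_star) (rule supp_simplex(2)[OF K fR[OF s]])
    then have "openin (top_of_set T) {t \<in> T. f t \<in> open_star K (f s)}"
      using openin_continuous_map_preimage[OF fc] by simp
    moreover have "s \<in> {t \<in> T. f t \<in> open_star K (f s)}"
      using s fR by (simp add: open_star_def)
    ultimately obtain e where e: "e > 0" "cball s e \<inter> T \<subseteq> {t \<in> T. f t \<in> open_star K (f s)}"
      unfolding openin_contains_cball by blast
    show ?thesis
    proof (intro exI conjI ballI impI)
      show "(if s = b then e else min e (dist s b)) > 0"
        using e(1) by simp
      show "f t \<in> open_star K (f s)"
        if "t \<in> T" "dist s t \<le> (if s = b then e else min e (dist s b))" for t
      proof -
        have "t \<in> cball s e \<inter> T"
          using that by (auto split: if_splits)
        then show ?thesis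
          using e(2) by blast
      qed
    qed simp
  qed
  then obtain r where r: "\<And>s. s \<in> T \<Longrightarrow> r s > 0"
      "\<And>s t. s \<in> T \<Longrightarrow> t \<in> T \<Longrightarrow> dist s t \<le> r s \<Longrightarrow> f t \<in> open_star K (f s)"
      "\<And>s. s \<in> T \<Longrightarrow> s \<noteq> b \<Longrightarrow> r s \<le> dist s b"
    by metis
  have "T \<subseteq> (\<Union>s\<in>T. ball s (r s))"
    using r(1) by force
  then obtain J where J: "J \<subseteq> T" "finite J" "T \<subseteq> (\<Union>s\<in>J. ball s (r s))"
    using compactE_image[OF T(1), of T "\<lambda>s. ball s (r s)"] by auto
  \<comment> \<open>Tent functions: \<open>\<rho> s\<close> is positive exactly on the open ball of
    radius \<open>r s\<close>, so the finite cover makes their sum positive on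
    \<open>T\<close>.\<close>
  define \<rho> where "\<rho> s t = max 0 (r s - dist s t)" for s t
  define \<Sigma>\<rho> where "\<Sigma>\<rho> t = (\<Sum>s\<in>J. \<rho> s t)" for t
  define h where "h t v = (\<Sum>s\<in>J. \<rho> s t * f s v) / \<Sigma>\<rho> t" for t v
  define W where "W = (\<Inter>s\<in>J. {g \<in> cmaps (top_of_set T) ?R. g ` (cball s (r s) \<inter> T) \<subseteq> open_star K (f s)})"
  have \<rho>_nonneg: "\<rho> s t \<ge> 0" for s t
    by (simp add: \<rho>_def)
  have \<Sigma>_pos: "\<Sigma>\<rho> t > 0" if t: "t \<in> T" for t
  proof -
    obtain s where s: "s \<in> J" "dist s t < r s"
      using J(3) t by auto
    then have "0 < \<rho> s t"
      by (simp add: \<rho>_def)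
    then show ?thesis
      unfolding \<Sigma>\<rho>_def using s(1) J(2) \<rho>_nonneg by (intro sum_pos2)
  qed
  \<comment> \<open>The open ball around any other centre misses \<open>b\<close>, so covering
    \<open>b\<close> forces its own ball into the finite subcover.\<close>
  have bJ: "b \<in> J"
  proof -
    obtain s where "s \<in> J" "dist s b < r s"
      using J(3) T(2) by auto
    with r(3)[of s] J(1) show ?thesis
      by fastforce
  qed
  \<comment> \<open>Only the summand centred at \<open>b\<close> survives at \<open>b\<close>, so
    \<open>h b\<close> is \<open>f b\<close>; this makes the homotopy pointed.\<close>
  have hb: "h b = x"
  proof
    fix v
    have "\<rho> s b = 0" if "s \<in> J - {b}" for s
      using that r(3)[of s] J(1) by (auto simp: \<rho>_def)
    then have "\<Sigma>\<rho> b = \<rho> b b" "(\<Sum>s\<in>J. \<rho> s b * f s v) = \<rho> b b * f b v"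
      unfolding \<Sigma>\<rho>_def using bJ J(2) by (simp_all add: sum.remove)
    then show "h b v = x v"
      using \<Sigma>_pos[OF T(2)] fb by (simp add: h_def)
  qed
  have openW: "openin (compact_open (top_of_set T) ?R) W"
    unfolding W_def
  proof (rule openin_INT2)
    fix s assume s: "s \<in> J"
    have "compact (cball s (r s) \<inter> T)"
      using T(1) closed_cball by (rule closed_Int_compact[rotated])
    then show "openin (compact_open (top_of_set T) ?R)
        {g \<in> cmaps (top_of_set T) ?R. g ` (cball s (r s) \<inter> T) \<subseteq> open_star K (f s)}"
      using s J(1) supp_simplex(2)[OF K fR]
      by (intro openin_compact_open openin_open_star) (auto simp: compactin_subtopology)
  qed (use J bJ in auto)
  have fW: "f \<in> W"
    unfolding W_def using r(2) J(1) fext by auto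
  have homotopic_h: "phomotopic (top_of_set T, b) (?R, x) g h"
    if gW: "g \<in> W" and g: "g \<in> pmaps (top_of_set T, b) (?R, x)" for g
  proof -
    have gc: "continuous_map (top_of_set T) ?R g" and gb: "g b = x"
      using g by (auto simp: pmaps_def cmaps_def)
    have gR: "g t \<in> topspace ?R" if "t \<in> T" for t
      using gc that by (auto simp: continuous_map_def)
    have star: "supp (f s) \<subseteq> supp (g t)" if "s \<in> J" "t \<in> T" "\<rho> s t \<noteq> 0" for s t
    proof -
      have "t \<in> cball s (r s) \<inter> T"
        using that by (auto simp: \<rho>_def max_def split: if_splits)
      then have "g t \<in> open_star K (f s)"
        using gW that(1) unfolding W_def by blast
      then show ?thesis
        by (simp add: open_star_def)
    qed
    have h_simplex: "h t \<in> closed_simplex (supp (g t))" if t: "t \<in> T" for t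
    proof -
      have nonneg: "0 \<le> h t v" for v
        unfolding h_def
      proof (intro divide_nonneg_pos sum_nonneg mult_nonneg_nonneg \<rho>_nonneg \<Sigma>_pos[OF t])
        fix s assume "s \<in> J"
        then show "0 \<le> f s v"
          using J(1) supp_simplex(3)[OF K fR] by (auto simp: closed_simplex_def)
      qed
      have zero: "h t v = 0" if "v \<notin> supp (g t)" for v
      proof -
        have "\<rho> s t * f s v = 0" if "s \<in> J" for s
          using star[OF that t] \<open>v \<notin> supp (g t)\<close> by auto
        then have "(\<Sum>s\<in>J. \<rho> s t * f s v) = 0"
          by (intro sum.neutral ballI)
        then show ?thesis
          by (simp add: h_def)
      qed
      have "\<rho> s t * sum (f s) (supp (g t)) = \<rho> s t" if s: "s \<in> J" for s
      proof (cases "\<rho> s t = 0")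
        case False
        have fs: "f s \<in> topspace ?R"
          using s J(1) fR by blast
        have "f s \<in> closed_simplex (supp (g t))"
          by (rule closed_simplexI[OF supp_simplex(3,2)[OF K fs] star[OF s t False] supp_simplex(2)[OF K gR[OF t]]])
        then show ?thesis
          by (simp add: closed_simplex_def)
      qed simp
      then have "(\<Sum>s\<in>J. \<rho> s t * sum (f s) (supp (g t))) = \<Sigma>\<rho> t"
        unfolding \<Sigma>\<rho>_def by (intro sum.cong) auto
      moreover have "sum (h t) (supp (g t)) = (\<Sum>s\<in>J. \<rho> s t * sum (f s) (supp (g t))) / \<Sigma>\<rho> t"
        unfolding h_def sum_divide_distrib[symmetric] sum_distrib_left by (subst sum.swap) simp
      ultimately have "sum (h t) (supp (g t)) = 1"
        using \<Sigma>_pos[OF t] by simp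
      with nonneg zero show ?thesis
        by (simp add: closed_simplex_def)
    qed
    \<comment> \<open>The coordinates of \<open>H\<close> are continuous, which suffices for the
      weak topology only inside finitely many simplices. Compactness of the image of
      \<open>g\<close> provides them, and each segment stays in a simplex containing
      \<open>g t\<close>.\<close>
    have "compactin ?R (g ` T)"
      using image_compactin[OF _ gc, of T] T(1) by (simp add: compactin_subtopology)
    then obtain F where F: "finite F" "F \<subseteq> K" "g ` T \<subseteq> \<Union> (closed_simplex ` F)"
      using compactin_realization_finite[OF K] by blast
    define H where "H = (\<lambda>(u, t) v. (1 - u) * g t v + u * h t v)"
    have gcoord: "continuous_on T (\<lambda>t. g t v)" for v
    proof -
      have "continuous_map (top_of_set T) euclidean ((\<lambda>\<alpha>. \<alpha>) \<circ> g)"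
        using gc continuous_map_realization_euclidean by (rule continuous_map_compose)
      then have "continuous_on T g"
        by (simp add: o_def)
      then show ?thesis
        by (rule continuous_on_product_then_coordinatewise)
    qed
    have \<rho>c: "continuous_on T (\<rho> s)" for s
      unfolding \<rho>_def by (intro continuous_intros)
    have hcoord: "continuous_on T (\<lambda>t. h t v)" for v
      unfolding h_def \<Sigma>\<rho>_def
      by (intro continuous_intros \<rho>c) (use \<Sigma>_pos in \<open>force simp: \<Sigma>\<rho>_def\<close>)
    have "continuous_on ({0..1} \<times> T) (\<lambda>z. H z v)" for v
      unfolding H_def case_prod_beta
      by (intro continuous_intros continuous_on_compose2[OF gcoord continuous_on_snd]
          continuous_on_compose2[OF hcoord continuous_on_snd]) auto
    then have "continuous_on ({0..1} \<times> T) H"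
      by (rule continuous_on_coordinatewise_then_product)
    then have "continuous_map (prod_topology (top_of_set {0..1}) (top_of_set T)) ?R H"
    proof (intro continuous_map_into_realization[OF F(1,2)])
      fix z :: "real \<times> 'm" assume "z \<in> topspace (prod_topology (top_of_set {0..1}) (top_of_set T))"
      then obtain u t where z: "z = (u, t)" "0 \<le> u" "u \<le> 1" "t \<in> T"
        by auto
      obtain \<sigma> where \<sigma>: "\<sigma> \<in> F" "g t \<in> closed_simplex \<sigma>"
        using F(3) z(4) by blast
      have "finite \<sigma>"
        using K F(2) \<sigma>(1) by (auto simp: abstract_simplicial_complex_def)
      then have hs: "h t \<in> closed_simplex \<sigma>"
        using closed_simplex_mono[OF supp_subset[OF \<sigma>(2)]] h_simplex[OF z(4)] by blast
      have "sum (H z) \<sigma> = (1 - u) * sum (g t) \<sigma> + u * sum (h t) \<sigma>"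
        unfolding z(1) H_def by (simp add: sum.distrib sum_distrib_left)
      then have "H z \<in> closed_simplex \<sigma>"
        using \<sigma>(2) hs z by (auto simp: closed_simplex_def H_def)
      with \<sigma>(1) show "H z \<in> \<Union> (closed_simplex ` F)"
        by blast
    qed simp
    moreover have "H (u, b) = x" for u
      by (simp add: H_def gb hb fun_eq_iff algebra_simps)
    moreover have "H (0, t) = g t" "H (1, t) = h t" for t
      by (simp_all add: H_def)
    ultimately show ?thesis
      unfolding phomotopic_def homotopic_with_def by (intro exI[of _ H]) auto
  qed
  \<comment> \<open>\<open>h\<close> is built from \<open>f\<close> alone, and \<open>f\<close>
    itself belongs to \<open>W\<close>, so every pointed \<open>g\<close> in \<open>W\<close> is
    joined to \<open>f\<close> through \<open>h\<close>.\<close>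
  show thesis
  proof (rule that[OF openW fW])
    fix g assume "g \<in> W" "g \<in> pmaps (top_of_set T, b) (?R, x)"
    then show "phomotopic (top_of_set T, b) (?R, x) f g"
      using homotopic_h[OF fW f] homotopic_h[of g] by (blast intro: phomotopic_trans phomotopic_sym)
  qed
qed

text \<open>The functions \<open>nat \<Rightarrow> real\<close> form a metric space for the product
  topology, so this form makes \<open>phomotopic_nearby\<close> applicable to the sphere.\<close>

lemma nsphere_top_of_set: "nsphere k = top_of_set (topspace (nsphere k))"
  by (simp add: nsphere euclidean_product_topology)

lemma compact_nsphere: "compact (topspace (nsphere k))"
proof -
  \<comment> \<open>A compact product that contains the sphere: coordinates up to \<open>k\<close>
    are bounded by 1, the later ones vanish.\<close>
  let ?B = "Pi\<^sub>E UNIV (\<lambda>i. if i \<le> k then {-1..1} else {0}) :: (nat \<Rightarrow> real) set"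
  have "compactin (powertop_real UNIV) ?B"
    by (subst compactin_PiE) auto
  then have "compact ?B"
    by (simp add: euclidean_product_topology)
  moreover have "closed (topspace (nsphere k))"
  proof -
    have "topspace (nsphere k) = {x. (\<Sum>i\<le>k. (x i)\<^sup>2) = 1} \<inter> (\<Inter>i\<in>{k<..}. {x. x i = 0})"
      by (auto simp: nsphere)
    moreover have "closed \<dots>"
      by (intro closed_Int closed_INT ballI closed_Collect_eq continuous_intros) auto
    ultimately show ?thesis
      by simp
  qed
  moreover have "topspace (nsphere k) \<subseteq> ?B"
  proof
    fix x assume x: "x \<in> topspace (nsphere k)"
    have "\<bar>x i\<bar> \<le> 1" if "i \<le> k" for i
    proof -
      have "(x i)\<^sup>2 \<le> (\<Sum>i\<le>k. (x i)\<^sup>2)"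
        using that by (intro member_le_sum) auto
      also have "\<dots> = 1"
        using x by (simp add: nsphere)
      finally show ?thesis
        by (simp add: abs_square_le_1)
    qed
    with x show "x \<in> ?B"
      by (auto simp: nsphere abs_le_iff)
  qed
  ultimately show ?thesis
    using closed_Int_compact[of "topspace (nsphere k)" ?B] by (simp add: Int_absorb2)
qed

lemma pointed_psphere: "pointed_space (psphere k)"
  using in_topspace_nsphere by (simp add: pointed_space_def sphere_base_def)

text \<open>The space is only homotopy equivalent to a polyhedron, so the neighbourhood from
  \<open>phomotopic_nearby\<close> is pulled back along the equivalence \<open>a\<close>. If
  \<open>f\<close> and \<open>g\<close> become homotopic after \<open>a\<close>, they are homotopic,
  since \<open>b\<close> after \<open>a\<close> is homotopic to the identity. Homotopy classes are
  then open in the loop space, hence points are open in the quotient.\<close>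

lemma pi_qtop_discrete:
  fixes V :: "'v itself" and A :: "'p pspace"
  assumes "HPol V A"
  shows "pi_qtop k A = discrete_topology (hTop_hom (psphere k) A)"
proof -
  have A: "pointed_space A"
    using assms by (rule HPol_pointed)
  obtain K :: "'v set set" and x where K: "abstract_simplicial_complex K" "x \<in> topspace (realization K)"
    and iso: "hTop_isomorphic A (realization K, x)"
    using assms by (auto simp: HPol_def)
  obtain c d where c: "c \<in> hTop_hom A (realization K, x)" and d: "d \<in> hTop_hom (realization K, x) A"
    and dc: "hTop_comp A A d c = hTop_id A"
    using iso by (auto simp: hTop_isomorphic_def)
  obtain a where a: "a \<in> pmaps A (realization K, x)" "c = hclass A (realization K, x) a"
    using c by (rule hTop_homE)
  obtain b where b: "b \<in> pmaps (realization K, x) A" "d = hclass (realization K, x) A b"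
    using d by (rule hTop_homE)
  let ?ba = "compose (topspace (fst A)) b a" and ?id = "restrict id (topspace (fst A))"
  have "?id \<in> pmaps A A"
    using A by (auto simp: pmaps_def cmaps_def pointed_space_def intro: continuous_map_eq[OF continuous_map_id])
  then have ba: "phomotopic A A ?ba ?id"
    using dc hTop_comp_hclass[OF A a(1) b(1)] a(2) b(2) by (simp add: hTop_id_def hclass_eq_iff)
  let ?S = "topspace (nsphere k)"
  have top: "topspace (loop_space k A) = pmaps (psphere k) A"
    by (auto simp: loop_space_def topspace_compact_open pmaps_def)
  have retract: "phomotopic (psphere k) A f (compose ?S b (compose ?S a f))"
    if f: "f \<in> pmaps (psphere k) A" for f
  proof -
    have *: "phomotopic (psphere k) A (compose ?S ?ba f) (compose ?S ?id f)"
      using phomotopic_compose_right[OF pointed_psphere f ba] by (simp only: fst_conv)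
    have "f y \<in> topspace (fst A)" if "y \<in> ?S" for y
      using f that by (auto simp: pmaps_def cmaps_def continuous_map_def)
    then have "phomotopic (psphere k) A (compose ?S b (compose ?S a f)) f"
      by (intro phomotopic_eq[OF pointed_psphere *]) (auto simp: compose_def)
    then show ?thesis
      by (rule phomotopic_sym)
  qed
  have nbhd: "\<exists>W. openin (loop_space k A) W \<and> f \<in> W \<and>
      (\<forall>g\<in>W. hclass (psphere k) A g = hclass (psphere k) A f)"
    if f: "f \<in> pmaps (psphere k) A" for f
  proof -
    have af: "compose ?S a f \<in> pmaps (psphere k) (realization K, x)"
      using pmaps_compose[OF pointed_psphere f a(1)] by simp
    obtain W where W: "openin (compact_open (nsphere k) (realization K)) W" "compose ?S a f \<in> W"
      "\<And>g. g \<in> W \<Longrightarrow> g \<in> pmaps (psphere k) (realization K, x) \<Longrightarrow>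
        phomotopic (psphere k) (realization K, x) (compose ?S a f) g"
      using phomotopic_nearby[OF K(1) compact_nsphere, of sphere_base k "compose ?S a f" x] af pointed_psphere[of k]
      unfolding nsphere_top_of_set[symmetric] pointed_space_def by auto
    let ?W = "{g \<in> topspace (compact_open (nsphere k) (fst A)). compose ?S a g \<in> W}"
    have "continuous_map (fst A) (realization K) a"
      using a(1) by (simp add: pmaps_def cmaps_def)
    from openin_continuous_map_preimage[OF continuous_map_compact_open_compose[OF this] W(1)]
    have "openin (loop_space k A) (?W \<inter> pmaps (psphere k) A)"
      unfolding loop_space_def by (rule openin_subtopology_Int)
    moreover have "f \<in> ?W \<inter> pmaps (psphere k) A"
      using f W(2) by (auto simp: topspace_compact_open pmaps_def)
    moreover have "\<forall>g \<in> ?W \<inter> pmaps (psphere k) A. hclass (psphere k) A g = hclass (psphere k) A f"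
    proof
      fix g assume g: "g \<in> ?W \<inter> pmaps (psphere k) A"
      have gp: "g \<in> pmaps (psphere k) A"
        using g by (rule IntD2)
      have gW: "compose ?S a g \<in> W"
        using CollectD[OF IntD1[OF g]] by (rule conjunct2)
      have "compose ?S a g \<in> pmaps (psphere k) (realization K, x)"
        using pmaps_compose[OF pointed_psphere gp a(1)] by simp
      from phomotopic_compose_left[OF pointed_psphere W(3)[OF gW this] b(1)]
      have *: "phomotopic (psphere k) A (compose ?S b (compose ?S a f)) (compose ?S b (compose ?S a g))"
        by (simp only: fst_conv)
      from phomotopic_trans[OF phomotopic_trans[OF retract[OF f] *] phomotopic_sym[OF retract[OF gp]]]
      show "hclass (psphere k) A g = hclass (psphere k) A f"
        by (rule hclass_cong[symmetric])
    qed
    ultimately have "openin (loop_space k A) (?W \<inter> pmaps (psphere k) A) \<and>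
        f \<in> ?W \<inter> pmaps (psphere k) A \<and>
        (\<forall>g \<in> ?W \<inter> pmaps (psphere k) A. hclass (psphere k) A g = hclass (psphere k) A f)"
      by (intro conjI)
    then show ?thesis
      by (rule exI)
  qed
  have "openin (pi_qtop k A) U" if U: "U \<subseteq> hTop_hom (psphere k) A" for U
  proof -
    have "openin (loop_space k A) {f \<in> pmaps (psphere k) A. hclass (psphere k) A f \<in> U}"
    proof (rule iffD2[OF openin_subopen], intro ballI)
      fix f assume f: "f \<in> {f \<in> pmaps (psphere k) A. hclass (psphere k) A f \<in> U}"
      then obtain W where W: "openin (loop_space k A) W" "f \<in> W"
          "\<forall>g\<in>W. hclass (psphere k) A g = hclass (psphere k) A f"
        using nbhd by blast
      have "W \<subseteq> {f \<in> pmaps (psphere k) A. hclass (psphere k) A f \<in> U}"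
      proof (intro subsetI CollectI conjI)
        fix g assume g: "g \<in> W"
        then show "g \<in> pmaps (psphere k) A"
          using openin_subset[OF W(1)] unfolding top by (rule set_mp[rotated])
        show "hclass (psphere k) A g \<in> U"
          unfolding bspec[OF W(3) g] using CollectD[OF f] by (rule conjunct2)
      qed
      with W(1,2) show "\<exists>W. openin (loop_space k A) W \<and> f \<in> W \<and>
          W \<subseteq> {f \<in> pmaps (psphere k) A. hclass (psphere k) A f \<in> U}"
        by (intro exI[of _ W] conjI)
    qed
    then show ?thesis
      using U by (simp add: pi_qtop_def openin_quot_topology top hTop_hom_def)
  qed
  moreover have "topspace (pi_qtop k A) = hTop_hom (psphere k) A"
    using quotient_imp_surjective_map[OF quotient_map_quot_topology[of "loop_space k A" "hclass (psphere k) A"]]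
    by (simp add: pi_qtop_def top hTop_hom_def)
  ultimately show ?thesis
    using discrete_topology_unique[of "hTop_hom (psphere k) A" "pi_qtop k A"] by simp
qed

section \<open>The quotient map from the cube to the sphere\<close>

text \<open>Not cut down to \<open>unit_cube\<close>, because \<open>cube_to_sphere\<close> is
  defined, and turns out to be continuous, on all functions.\<close>

definition cube_boundary :: "nat \<Rightarrow> (nat \<Rightarrow> real) set" where
  "cube_boundary k = {t. \<exists>i<k. t i = 0 \<or> t i = 1}"

text \<open>On the open unit interval this is an increasing homeomorphism onto the line, equal to
  \<open>(2 * s - 1) / (s * (1 - s))\<close>.\<close>

definition stretch :: "real \<Rightarrow> real" where
  "stretch s = 1 / (1 - s) - 1 / s"

lemma cube_to_sphere_boundary: "t \<in> cube_boundary k \<Longrightarrow> cube_to_sphere k t = sphere_base"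
  by (simp add: cube_boundary_def cube_to_sphere_def)

text \<open>Inverse stereographic projection from \<open>sphere_base\<close>: coordinate 0 of the
  sphere is the height, so cube coordinate \<open>i\<close> reappears at
  \<open>Suc i\<close>.\<close>

lemma cube_to_sphere_interior:
  assumes "t \<notin> cube_boundary k"
  defines "R \<equiv> \<Sum>i<k. (stretch (t i))\<^sup>2"
  shows "cube_to_sphere k t 0 = (R - 1) / (R + 1)"
    and "i < k \<Longrightarrow> cube_to_sphere k t (Suc i) = 2 * stretch (t i) / (R + 1)"
    and "i > k \<Longrightarrow> cube_to_sphere k t i = 0"
proof -
  have "\<not> (\<exists>i<k. t i = 0 \<or> t i = 1)"
    using assms(1) by (simp add: cube_boundary_def)
  then have eq: "cube_to_sphere k t =
      (\<lambda>i. if i = 0 then (R - 1) / (R + 1) else if i \<le> k then 2 * stretch (t (i - 1)) / (R + 1) else 0)"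
    unfolding cube_to_sphere_def R_def stretch_def Let_def by (simp only: if_False)
  show "cube_to_sphere k t 0 = (R - 1) / (R + 1)"
    and "i < k \<Longrightarrow> cube_to_sphere k t (Suc i) = 2 * stretch (t i) / (R + 1)"
    and "i > k \<Longrightarrow> cube_to_sphere k t i = 0"
    by (simp_all add: eq)
qed

lemma sphere_base_in_nsphere: "sphere_base \<in> topspace (nsphere k)"
  using in_topspace_nsphere by (simp add: sphere_base_def)

lemma in_nsphere_iff:
  "x \<in> topspace (nsphere k) \<longleftrightarrow> (x 0)\<^sup>2 + (\<Sum>i<k. (x (Suc i))\<^sup>2) = 1 \<and> (\<forall>i>k. x i = 0)"
  by (auto simp: nsphere sum.atMost_shift)

lemma cube_to_sphere_in_nsphere: "cube_to_sphere k t \<in> topspace (nsphere k)"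
proof (cases "t \<in> cube_boundary k")
  case True
  then show ?thesis
    by (simp add: cube_to_sphere_boundary sphere_base_in_nsphere)
next
  case False
  define R where "R = (\<Sum>i<k. (stretch (t i))\<^sup>2)"
  have R: "R \<ge> 0"
    unfolding R_def by (intro sum_nonneg) simp
  note c = cube_to_sphere_interior[OF False, folded R_def]
  have "(\<Sum>i<k. (cube_to_sphere k t (Suc i))\<^sup>2) = (\<Sum>i<k. 4 / (R + 1)\<^sup>2 * (stretch (t i))\<^sup>2)"
    by (intro sum.cong) (auto simp: c(2) power_mult_distrib power_divide)
  also have "\<dots> = 4 / (R + 1)\<^sup>2 * R"
    unfolding R_def by (rule sum_distrib_left[symmetric])
  finally have "(cube_to_sphere k t 0)\<^sup>2 + (\<Sum>i<k. (cube_to_sphere k t (Suc i))\<^sup>2) =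
      ((R - 1)\<^sup>2 + 4 * R) / (R + 1)\<^sup>2"
    by (simp add: c(1) power_divide add_divide_distrib)
  also have "(R - 1)\<^sup>2 + 4 * R = (R + 1)\<^sup>2"
    by (simp add: power2_eq_square algebra_simps)
  finally show ?thesis
    using R c(3) by (simp add: in_nsphere_iff)
qed

lemma stretch_strict_mono:
  assumes "0 < s" "s < s'" "s' < 1"
  shows "stretch s < stretch s'"
proof -
  have "1 / (1 - s) < 1 / (1 - s')" "1 / s' < 1 / s"
    using assms by (auto intro!: divide_strict_left_mono)
  then show ?thesis
    by (simp add: stretch_def)
qed

lemma stretch_surj: obtains s where "0 < s" "s < 1" "stretch s = y"
proof -
  \<comment> \<open>The equation \<open>stretch s = y\<close> multiplied by
    \<open>s * (1 - s)\<close>. The values at 0 and 1 are 1 and -1, which gives a root and keeps it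
    off both ends.\<close>
  let ?g = "\<lambda>s. y * s * (1 - s) - (2 * s - 1)"
  have "\<exists>s\<ge>0. s \<le> 1 \<and> ?g s = 0"
    by (rule IVT2') (auto intro!: continuous_intros)
  then obtain s where s: "0 \<le> s" "s \<le> 1" "?g s = 0"
    by blast
  have "s \<noteq> 0" "s \<noteq> 1"
    using s(3) by auto
  with s have "0 < s" "s < 1" "stretch s = y"
    by (auto simp: stretch_def field_simps)
  then show thesis
    by (rule that)
qed

lemma cube_interior_bounds:
  assumes "t \<in> unit_cube k" "t \<notin> cube_boundary k" "i < k"
  shows "0 < t i" "t i < 1"
  using assms by (force simp: unit_cube_def cube_boundary_def order.strict_iff_order)+

lemma cube_to_sphere_interior_neq_base:
  assumes "t \<notin> cube_boundary k"
  shows "cube_to_sphere k t \<noteq> sphere_base"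
proof
  assume eq: "cube_to_sphere k t = sphere_base"
  define R where "R = (\<Sum>i<k. (stretch (t i))\<^sup>2)"
  have "R \<ge> 0"
    unfolding R_def by (intro sum_nonneg) simp
  moreover have "(R - 1) / (R + 1) = 1"
    using cube_to_sphere_interior(1)[OF assms, folded R_def] eq by (simp add: sphere_base_def)
  ultimately show False
    by (simp add: field_simps)
qed

text \<open>Off the boundary the height \<open>(R - 1) / (R + 1)\<close> determines
  \<open>R\<close>, after which the other coordinates determine each \<open>stretch (t i)\<close>,
  and \<open>stretch\<close> is injective.\<close>

lemma cube_to_sphere_eqD:
  assumes t: "t \<in> unit_cube k" and t': "t' \<in> unit_cube k"
    and eq: "cube_to_sphere k t = cube_to_sphere k t'"
  shows "t = t' \<or> t \<in> cube_boundary k \<and> t' \<in> cube_boundary k"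
proof (cases "t \<in> cube_boundary k \<or> t' \<in> cube_boundary k")
  case True
  then show ?thesis
    using eq cube_to_sphere_boundary cube_to_sphere_interior_neq_base by metis
next
  case False
  define R where "R = (\<Sum>i<k. (stretch (t i))\<^sup>2)"
  define R' where "R' = (\<Sum>i<k. (stretch (t' i))\<^sup>2)"
  have R: "R \<ge> 0" "R' \<ge> 0"
    unfolding R_def R'_def by (intro sum_nonneg; simp)+
  have nb: "t \<notin> cube_boundary k" "t' \<notin> cube_boundary k"
    using False by auto
  note c = cube_to_sphere_interior[OF nb(1), folded R_def]
  note c' = cube_to_sphere_interior[OF nb(2), folded R'_def]
  have "(R - 1) / (R + 1) = (R' - 1) / (R' + 1)"
    using c(1) c'(1) eq by simp
  then have "R = R'"
    using R by (simp add: field_simps)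
  have "t i = t' i" for i
  proof (cases "i < k")
    case True
    have "2 * stretch (t i) / (R + 1) = 2 * stretch (t' i) / (R' + 1)"
      using c(2)[OF True] c'(2)[OF True] eq by simp
    then have "stretch (t i) = stretch (t' i)"
      using R \<open>R = R'\<close> by simp
    then show ?thesis
      using stretch_strict_mono[of "t i" "t' i"] stretch_strict_mono[of "t' i" "t i"]
        cube_interior_bounds[OF t nb(1) True] cube_interior_bounds[OF t' nb(2) True]
      by (metis less_irrefl linorder_neqE_linordered_idom)
  next
    case False
    then show ?thesis
      using t t' by (simp add: unit_cube_def)
  qed
  then show ?thesis
    by blast
qed

lemma cube_to_sphere_surj:
  assumes k: "k \<ge> 1" and x: "x \<in> topspace (nsphere k)"
  obtains t where "t \<in> unit_cube k" "cube_to_sphere k t = x"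
proof (cases "x 0 = 1")
  case True
  then have "(\<Sum>i<k. (x (Suc i))\<^sup>2) = 0"
    using x by (simp add: in_nsphere_iff)
  then have "x (Suc i) = 0" if "i < k" for i
    using that by (simp add: sum_nonneg_eq_0_iff)
  moreover have "x i = 0" if "i > k" for i
    using x that by (simp add: in_nsphere_iff)
  ultimately have "x i = 0" if "i \<noteq> 0" for i
    using that by (metis Suc_le_eq not0_implies_Suc not_le)
  then have "x = sphere_base"
    using True by (auto simp: sphere_base_def)
  \<comment> \<open>Only boundary points map to the base point, and there are some because
    \<open>k \<ge> 1\<close>.\<close>
  moreover have "(\<lambda>_. 0) \<in> unit_cube k" "(\<lambda>_. 0) \<in> cube_boundary k"
    using k by (auto simp: unit_cube_def cube_boundary_def intro!: exI[of _ 0])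
  ultimately show thesis
    using that cube_to_sphere_boundary by metis
next
  case False
  have sum: "(x 0)\<^sup>2 + (\<Sum>i<k. (x (Suc i))\<^sup>2) = 1"
    using x by (simp add: in_nsphere_iff)
  moreover have "(\<Sum>i<k. (x (Suc i))\<^sup>2) \<ge> 0"
    by (intro sum_nonneg) simp
  ultimately have "(x 0)\<^sup>2 \<le> 1"
    by linarith
  then have "x 0 < 1"
    using False by (simp add: abs_square_le_1 abs_le_iff)
  \<comment> \<open>The quotients are the stereographic projection of \<open>x\<close> from
    \<open>sphere_base\<close>; \<open>stretch\<close> pulls them back to the cube.\<close>
  have "\<exists>s. 0 < s \<and> s < 1 \<and> stretch s = x (Suc i) / (1 - x 0)" for i
    using stretch_surj by metis
  then obtain s where s: "\<And>i. 0 < s i" "\<And>i. s i < 1" "\<And>i. stretch (s i) = x (Suc i) / (1 - x 0)"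
    by metis
  define t where "t i = (if i < k then s i else 0)" for i
  have t: "t \<in> unit_cube k"
    using s by (auto simp: t_def unit_cube_def less_imp_le)
  have nb: "t \<notin> cube_boundary k"
    using s by (auto simp: t_def cube_boundary_def less_le)
  define R where "R = (\<Sum>i<k. (stretch (t i))\<^sup>2)"
  have "R = (\<Sum>i<k. (x (Suc i))\<^sup>2 / (1 - x 0)\<^sup>2)"
    unfolding R_def by (intro sum.cong) (auto simp: t_def s(3) power_divide)
  also have "\<dots> = (1 - (x 0)\<^sup>2) / (1 - x 0)\<^sup>2"
    using sum by (simp add: sum_divide_distrib[symmetric] algebra_simps)
  also have "\<dots> = (1 + x 0) / (1 - x 0)"
  proof -
    have "1 - (x 0)\<^sup>2 = (1 + x 0) * (1 - x 0)"
      by (simp add: power2_eq_square algebra_simps)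
    then show ?thesis
      using False by (simp add: power2_eq_square)
  qed
  finally have R: "R = (1 + x 0) / (1 - x 0)" .
  then have R1: "R + 1 = 2 / (1 - x 0)" "R - 1 = 2 * x 0 / (1 - x 0)"
    using \<open>x 0 < 1\<close> by (simp_all add: field_simps)
  note c = cube_to_sphere_interior[OF nb, folded R_def]
  have "cube_to_sphere k t i = x i" for i
  proof (cases i)
    case 0
    then show ?thesis
      using c(1) R1 \<open>x 0 < 1\<close> by simp
  next
    case (Suc j)
    show ?thesis
    proof (cases "j < k")
      case True
      then show ?thesis
        using c(2)[OF True] R1 \<open>x 0 < 1\<close> Suc by (simp add: t_def s(3))
    next
      case False
      then show ?thesis
        using c(3)[of i] x Suc by (simp add: in_nsphere_iff)
    qed
  qed
  then show thesis
    using that t by blast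
qed

text \<open>\<open>damping s = 1 / (1 + (stretch s)\<^sup>2)\<close> for \<open>0 < s < 1\<close>, in a form that is continuous everywhere.\<close>

definition damping :: "real \<Rightarrow> real" where
  "damping s = (s * (1 - s))\<^sup>2 / ((s * (1 - s))\<^sup>2 + (2 * s - 1)\<^sup>2)"

text \<open>The second square vanishes only at \<open>s = 1 / 2\<close>, where the first one is
  1/16.\<close>

lemma damping_denominator_pos: "(s * (1 - s))\<^sup>2 + (2 * s - 1)\<^sup>2 > (0 :: real)"
proof (cases "2 * s - 1 = 0")
  case True
  then have "s = 1 / 2"
    by linarith
  show ?thesis
    unfolding \<open>s = 1 / 2\<close> by (simp add: power2_eq_square)
next
  case False
  then show ?thesis
    by (intro add_nonneg_pos) auto
qed

lemma continuous_on_damping: "continuous_on UNIV damping"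
  unfolding damping_def
  by (intro continuous_intros ballI not_sym[OF less_imp_neq[OF damping_denominator_pos]])

lemma damping_stretch:
  assumes "s \<noteq> 0" "s \<noteq> 1"
  shows "damping s = 1 / (1 + (stretch s)\<^sup>2)"
proof -
  have w: "s * (1 - s) \<noteq> 0"
    using assms by simp
  have "stretch s = (2 * s - 1) / (s * (1 - s))"
    using assms by (simp add: stretch_def field_simps)
  then have "1 + (stretch s)\<^sup>2 = ((s * (1 - s))\<^sup>2 + (2 * s - 1)\<^sup>2) / (s * (1 - s))\<^sup>2"
    using w by (simp add: power_divide add_divide_distrib)
  then show ?thesis
    by (simp add: damping_def)
qed

text \<open>The estimate behind continuity at the boundary. One coordinate \<open>t j\<close> close
  to 0 or 1 makes \<open>R\<close> large whatever the other coordinates do, and every coordinate of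
  the image is within \<open>2 / sqrt (R + 1)\<close> of the base point.\<close>

lemma cube_to_sphere_near_base:
  assumes j: "j < k"
  shows "\<bar>cube_to_sphere k t i - sphere_base i\<bar> \<le> 2 * sqrt (damping (t j))"
proof (cases "t \<in> cube_boundary k")
  case True
  then show ?thesis
    using damping_denominator_pos[of "t j"] by (simp add: cube_to_sphere_boundary damping_def)
next
  case False
  define R where "R = (\<Sum>i<k. (stretch (t i))\<^sup>2)"
  note c = cube_to_sphere_interior[OF False, folded R_def]
  have le_R: "(stretch (t i))\<^sup>2 \<le> R" if "i < k" for i
    unfolding R_def using that by (intro member_le_sum) auto
  have R: "R \<ge> 0"
    unfolding R_def by (intro sum_nonneg) simp
  define E where "E = 1 / (R + 1)"
  have E: "0 < E" "E \<le> 1"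
    using R by (simp_all add: E_def)
  have "t j \<noteq> 0" "t j \<noteq> 1"
    using False j by (auto simp: cube_boundary_def)
  then have "E \<le> damping (t j)"
    using le_R[OF j] by (auto simp: E_def damping_stretch intro!: frac_le add_pos_nonneg)
  then have "sqrt E \<le> sqrt (damping (t j))"
    by simp
  moreover have "\<bar>cube_to_sphere k t i - sphere_base i\<bar> \<le> 2 * sqrt E"
  proof (cases i)
    case 0
    have "\<bar>cube_to_sphere k t i - sphere_base i\<bar> = 2 * E"
      using R 0 by (simp add: c(1) sphere_base_def E_def field_simps)
    moreover have "E \<le> sqrt E"
      using E by (intro real_le_rsqrt) (simp add: power2_eq_square mult_le_one mult_left_le)
    ultimately show ?thesis
      by simp
  next
    case (Suc l)
    show ?thesis
    proof (cases "l < k")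
      case True
      have "(stretch (t l) * E)\<^sup>2 = E * ((stretch (t l))\<^sup>2 * E)"
        by (simp add: power2_eq_square)
      also have "\<dots> \<le> E * 1"
        using E R le_R[OF True] by (intro mult_left_mono) (auto simp: E_def field_simps)
      finally have "\<bar>stretch (t l) * E\<bar> \<le> sqrt E"
        by (intro real_le_rsqrt) simp
      then show ?thesis
        using Suc c(2)[OF True] by (simp add: sphere_base_def E_def abs_mult)
    next
      case False
      then show ?thesis
        using Suc c(3)[of i] E by (simp add: sphere_base_def)
    qed
  qed
  ultimately show ?thesis
    by linarith
qed

lemma open_Compl_cube_boundary: "open (- cube_boundary k)"
proof -
  have "- cube_boundary k = (\<Inter>i\<in>{..<k}. {t. t i \<noteq> 0} \<inter> {t. t i \<noteq> 1})"
    by (auto simp: cube_boundary_def)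
  moreover have "open \<dots>"
    by (intro open_INT ballI open_Int open_Collect_neq continuous_intros) auto
  ultimately show ?thesis
    by simp
qed

text \<open>At the boundary the explicit formula breaks down, and
  \<open>cube_to_sphere_near_base\<close> squeezes each coordinate instead, as
  \<open>damping\<close> vanishes at 0 and 1. The complement of the boundary is open, so there the
  formula decides.\<close>

lemma continuous_on_cube_to_sphere: "continuous_on UNIV (cube_to_sphere k)"
proof (rule continuous_on_coordinatewise_then_product)
  fix i
  let ?c = "\<lambda>t. cube_to_sphere k t i"
  have "isCont ?c t" for t
  proof (cases "t \<in> cube_boundary k")
    case True
    then obtain j where j: "j < k" "t j = 0 \<or> t j = 1"
      by (auto simp: cube_boundary_def)
    have "continuous_on UNIV (\<lambda>t :: nat \<Rightarrow> real. 2 * sqrt (damping (t j)))"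
      by (intro continuous_intros continuous_on_compose2[OF continuous_on_damping]) auto
    then have "((\<lambda>t. 2 * sqrt (damping (t j))) \<longlongrightarrow> 2 * sqrt (damping (t j))) (at t)"
      by (simp add: continuous_on_def)
    moreover have "damping (t j) = 0"
      using j(2) by (auto simp: damping_def)
    ultimately have "((\<lambda>t. 2 * sqrt (damping (t j))) \<longlongrightarrow> 0) (at t)"
      by simp
    then have "((\<lambda>t. ?c t - sphere_base i) \<longlongrightarrow> 0) (at t)"
      by (rule Lim_null_comparison[rotated]) (use cube_to_sphere_near_base[OF j(1)] in simp)
    then show ?thesis
      unfolding isCont_def cube_to_sphere_boundary[OF True] by (rule LIM_zero_cancel)
  next
    case False
    let ?B = "- cube_boundary k"
    let ?R = "\<lambda>t. \<Sum>i<k. (stretch (t i))\<^sup>2"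
    have st: "continuous_on ?B (\<lambda>t. stretch (t l))" if "l < k" for l
      unfolding stretch_def
      by (intro continuous_intros continuous_on_subset[OF continuous_on_product_coordinates subset_UNIV])
        (use that in \<open>auto simp: cube_boundary_def\<close>)
    have R: "continuous_on ?B ?R"
      by (intro continuous_on_sum continuous_on_power st) simp
    have nz: "?R t + 1 \<noteq> 0" for t
    proof -
      have "?R t \<ge> 0"
        by (intro sum_nonneg) simp
      then show ?thesis
        by linarith
    qed
    have "continuous_on ?B ?c"
    proof (cases i)
      case 0
      have "continuous_on ?B (\<lambda>t. (?R t - 1) / (?R t + 1))"
        by (intro continuous_intros R ballI nz)
      then show ?thesis
        by (rule continuous_on_eq) (simp add: 0 cube_to_sphere_interior(1))
    next
      case (Suc l)
      show ?thesis
      proof (cases "l < k")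
        case True
        have "continuous_on ?B (\<lambda>t. 2 * stretch (t l) / (?R t + 1))"
          by (intro continuous_intros R st[OF True] ballI nz)
        then show ?thesis
          by (rule continuous_on_eq) (simp add: Suc True cube_to_sphere_interior(2))
      next
        case False
        have "continuous_on ?B (\<lambda>t. 0 :: real)"
          by (rule continuous_on_const)
        then show ?thesis
          by (rule continuous_on_eq) (use False in \<open>simp add: Suc cube_to_sphere_interior(3)\<close>)
      qed
    qed
    then show ?thesis
      using open_Compl_cube_boundary False by (simp add: continuous_on_eq_continuous_at)
  qed
  then show "continuous_on UNIV ?c"
    by (simp add: continuous_on_eq_continuous_at)
qed

lemma compact_unit_cube: "compact (unit_cube k)"
proof -
  have "t i \<in> (if i < k then {0..1} else {0}) \<longleftrightarrow>
      (i < k \<longrightarrow> 0 \<le> t i \<and> t i \<le> 1) \<and> (k \<le> i \<longrightarrow> t i = 0)" for t :: "nat \<Rightarrow> real" and i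
    by (cases "i < k") auto
  then have "unit_cube k = Pi\<^sub>E UNIV (\<lambda>i. if i < k then {0..1} else {0})"
    unfolding unit_cube_def PiE_UNIV_domain Pi_def by (intro Collect_cong) blast
  moreover have "compactin (powertop_real UNIV) \<dots>"
    by (subst compactin_PiE) auto
  ultimately show ?thesis
    by (simp add: euclidean_product_topology)
qed

section \<open>Induced maps are homomorphisms\<close>

text \<open>\<open>loop_mult\<close> before the passage to the quotient: a function on the cube,
  free of any choice of a preimage.\<close>

definition juxtapose :: "nat \<Rightarrow> ((nat \<Rightarrow> real) \<Rightarrow> 'p) \<Rightarrow> ((nat \<Rightarrow> real) \<Rightarrow> 'p) \<Rightarrow> (nat \<Rightarrow> real) \<Rightarrow> 'p" where
  "juxtapose k f g t = (if t 0 \<le> 1 / 2 then f (cube_to_sphere k (t(0 := 2 * t 0)))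
     else g (cube_to_sphere k (t(0 := 2 * t 0 - 1))))"

text \<open>A first coordinate 0 or 1 is fixed by the rescaling of its half, and the other
  coordinates do not change; so boundary points stay in the boundary.\<close>

lemma juxtapose_boundary:
  assumes "t \<in> cube_boundary k" "f sphere_base = y" "g sphere_base = y"
  shows "juxtapose k f g t = y"
proof -
  have "t(0 := 2 * t 0) \<in> cube_boundary k" if "t 0 \<le> 1 / 2"
  proof -
    obtain i where i: "i < k" "t i = 0 \<or> t i = 1"
      using assms(1) by (auto simp: cube_boundary_def)
    have "(t(0 := 2 * t 0)) i = 0 \<or> (t(0 := 2 * t 0)) i = 1"
      using i that by (cases "i = 0") auto
    with i(1) show ?thesis
      unfolding cube_boundary_def by blast
  qed
  moreover have "t(0 := 2 * t 0 - 1) \<in> cube_boundary k" if "\<not> t 0 \<le> 1 / 2"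
  proof -
    obtain i where i: "i < k" "t i = 0 \<or> t i = 1"
      using assms(1) by (auto simp: cube_boundary_def)
    have "(t(0 := 2 * t 0 - 1)) i = 0 \<or> (t(0 := 2 * t 0 - 1)) i = 1"
      using i that by (cases "i = 0") auto
    with i(1) show ?thesis
      unfolding cube_boundary_def by blast
  qed
  ultimately show ?thesis
    using assms(2,3) by (simp add: juxtapose_def cube_to_sphere_boundary)
qed

text \<open>Distinct points of the unit cube with the same image lie in the boundary, where
  \<open>juxtapose\<close> is constant; so it does not matter which preimage \<open>SOME\<close>
  picks.\<close>

lemma loop_mult_cube_to_sphere:
  assumes t: "t \<in> unit_cube k" and fg: "f sphere_base = g sphere_base"
  shows "loop_mult k f g (cube_to_sphere k t) = juxtapose k f g t"
proof -
  define t' where "t' = (SOME t'. t' \<in> unit_cube k \<and> cube_to_sphere k t' = cube_to_sphere k t)"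
  have "t' \<in> unit_cube k \<and> cube_to_sphere k t' = cube_to_sphere k t"
    unfolding t'_def by (rule someI[of _ t]) (simp add: t)
  then have "t' = t \<or> t' \<in> cube_boundary k \<and> t \<in> cube_boundary k"
    using t cube_to_sphere_eqD by blast
  then have "juxtapose k f g t' = juxtapose k f g t"
    using juxtapose_boundary[of _ k f _ g] fg by metis
  moreover have "loop_mult k f g (cube_to_sphere k t) = juxtapose k f g t'"
    by (simp add: loop_mult_def cube_to_sphere_in_nsphere t'_def juxtapose_def Let_def)
  ultimately show ?thesis
    by simp
qed

text \<open>The parameter set \<open>Z\<close> serves homotopies. Continuity is checked on
  \<open>Z\<close> times the cube and then descends, because a continuous surjection from a compact
  space onto a Hausdorff space is a quotient map; this bypasses the question whether products of
  quotient maps are quotient maps.\<close>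

lemma continuous_map_loop_mult:
  fixes Z :: "real set"
  assumes k: "k \<ge> 1" and Z: "compact Z"
    and h: "continuous_map (prod_topology (top_of_set Z) (nsphere k)) Y h"
    and h': "continuous_map (prod_topology (top_of_set Z) (nsphere k)) Y h'"
    and base: "\<And>z. z \<in> Z \<Longrightarrow> h (z, sphere_base) = y" "\<And>z. z \<in> Z \<Longrightarrow> h' (z, sphere_base) = y"
  shows "continuous_map (prod_topology (top_of_set Z) (nsphere k)) Y
    (\<lambda>(z, s). loop_mult k (\<lambda>s. h (z, s)) (\<lambda>s. h' (z, s)) s)"
proof -
  let ?S = "topspace (nsphere k)" and ?C = "unit_cube k"
  define q where "q = (\<lambda>(z :: real, t). (z, cube_to_sphere k t))"
  have cts: "continuous_on X (\<lambda>x. cube_to_sphere k (u x))" if "continuous_on X u" for X and u :: "real \<times> (nat \<Rightarrow> real) \<Rightarrow> _"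
    using continuous_on_compose2[OF continuous_on_cube_to_sphere that] by simp
  have prod: "prod_topology (top_of_set Z) (nsphere k) = top_of_set (Z \<times> ?S)"
    by (subst nsphere_top_of_set) simp
  have q_cont: "continuous_on (Z \<times> ?C) q"
    unfolding q_def case_prod_beta by (intro continuous_intros cts)
  have q_image: "q ` (Z \<times> ?C) = Z \<times> ?S"
  proof
    show "q ` (Z \<times> ?C) \<subseteq> Z \<times> ?S"
      using cube_to_sphere_in_nsphere by (auto simp: q_def)
    show "Z \<times> ?S \<subseteq> q ` (Z \<times> ?C)"
    proof
      fix w assume "w \<in> Z \<times> ?S"
      then obtain z s where w: "w = (z, s)" "z \<in> Z" "s \<in> ?S"
        by blast
      obtain t where "t \<in> ?C" "cube_to_sphere k t = s"
        using cube_to_sphere_surj[OF k w(3)] .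
      with w show "w \<in> q ` (Z \<times> ?C)"
        by (intro image_eqI[of _ _ "(z, t)"]) (auto simp: q_def)
    qed
  qed
  have "compact (Z \<times> ?C)"
    using Z compact_unit_cube by (rule compact_Times)
  then have "compact_space (top_of_set (Z \<times> ?C))"
    by (intro compact_space_subtopology) simp
  then have "quotient_map (top_of_set (Z \<times> ?C)) (top_of_set (Z \<times> ?S)) q"
    using q_cont q_image
    by (intro continuous_imp_quotient_map) (auto simp: Hausdorff_space_subtopology)
  moreover have "continuous_map (top_of_set (Z \<times> ?C)) Y
      ((\<lambda>(z, s). loop_mult k (\<lambda>s. h (z, s)) (\<lambda>s. h' (z, s)) s) \<circ> q)"
  proof (rule continuous_map_eq)
    let ?p = "\<lambda>w :: real \<times> (nat \<Rightarrow> real). snd w 0"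
    let ?l = "\<lambda>w :: real \<times> (nat \<Rightarrow> real). (fst w, cube_to_sphere k ((snd w)(0 := 2 * snd w 0)))"
    let ?r = "\<lambda>w :: real \<times> (nat \<Rightarrow> real). (fst w, cube_to_sphere k ((snd w)(0 := 2 * snd w 0 - 1)))"
    have coord: "continuous_on X (\<lambda>w :: real \<times> (nat \<Rightarrow> real). snd w i)" for X i
      by (rule continuous_on_product_then_coordinatewise[OF continuous_on_snd[OF continuous_on_id]])
    have upd: "continuous_on X (\<lambda>w :: real \<times> (nat \<Rightarrow> real). (snd w)(0 := c * snd w 0 - d))" for X c d
    proof (rule continuous_on_coordinatewise_then_product)
      show "continuous_on X (\<lambda>w. ((snd w)(0 := c * snd w 0 - d)) i)" for i
        by (cases "i = 0") (auto intro!: continuous_intros coord)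
    qed
    have p: "continuous_map (top_of_set (Z \<times> ?C)) euclideanreal ?p"
      using coord by simp
    have l: "continuous_map (top_of_set X) (top_of_set (Z \<times> ?S)) ?l"
      and r: "continuous_map (top_of_set X) (top_of_set (Z \<times> ?S)) ?r" if "X \<subseteq> Z \<times> ?C" for X
      using that cube_to_sphere_in_nsphere upd[of X 2 0] upd[of X 2 1]
      by (auto intro!: continuous_intros cts)
    show "continuous_map (top_of_set (Z \<times> ?C)) Y (\<lambda>w. if ?p w \<le> 1 / 2 then (h \<circ> ?l) w else (h' \<circ> ?r) w)"
    proof (rule continuous_map_cases_le[OF p])
      show "continuous_map (top_of_set (Z \<times> ?C)) euclideanreal (\<lambda>w. 1 / 2)"
        by simp
      show "continuous_map (subtopology (top_of_set (Z \<times> ?C)) {w \<in> topspace (top_of_set (Z \<times> ?C)). ?p w \<le> 1 / 2}) Y (h \<circ> ?l)"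
        unfolding subtopology_subtopology using h[unfolded prod]
        by (intro continuous_map_compose[OF l]) auto
      show "continuous_map (subtopology (top_of_set (Z \<times> ?C)) {w \<in> topspace (top_of_set (Z \<times> ?C)). 1 / 2 \<le> ?p w}) Y (h' \<circ> ?r)"
        unfolding subtopology_subtopology using h'[unfolded prod]
        by (intro continuous_map_compose[OF r]) auto
      fix w assume w: "w \<in> topspace (top_of_set (Z \<times> ?C))" "?p w = 1 / 2"
      \<comment> \<open>Along the seam the rescaled first coordinates are 1 and 0, so both halves
        have the value \<open>y\<close>.\<close>
      have "(snd w)(0 := 2 * snd w 0) \<in> cube_boundary k" "(snd w)(0 := 2 * snd w 0 - 1) \<in> cube_boundary k"
        using w(2) k by (auto simp: cube_boundary_def intro!: exI[of _ 0])
      then show "(h \<circ> ?l) w = (h' \<circ> ?r) w"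
        using w(1) by (auto simp: cube_to_sphere_boundary base)
    qed
    fix w assume w: "w \<in> topspace (top_of_set (Z \<times> ?C))"
    then obtain z t where zt: "w = (z, t)" "z \<in> Z" "t \<in> ?C"
      by auto
    have "loop_mult k (\<lambda>s. h (z, s)) (\<lambda>s. h' (z, s)) (cube_to_sphere k t) =
        juxtapose k (\<lambda>s. h (z, s)) (\<lambda>s. h' (z, s)) t"
      using zt(3) by (rule loop_mult_cube_to_sphere) (simp add: base zt(2))
    then show "(if ?p w \<le> 1 / 2 then (h \<circ> ?l) w else (h' \<circ> ?r) w) =
        ((\<lambda>(z, s). loop_mult k (\<lambda>s. h (z, s)) (\<lambda>s. h' (z, s)) s) \<circ> q) w"
      by (simp add: zt(1) q_def juxtapose_def)
  qed
  ultimately show ?thesis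
    unfolding prod by (rule continuous_compose_quotient_map)
qed

lemma loop_mult_base:
  assumes "k \<ge> 1" "f sphere_base = y" "g sphere_base = y"
  shows "loop_mult k f g sphere_base = y"
proof -
  have t: "(\<lambda>_. 0) \<in> unit_cube k" "(\<lambda>_. 0) \<in> cube_boundary k"
    using assms(1) by (auto simp: unit_cube_def cube_boundary_def intro!: exI[of _ 0])
  have "loop_mult k f g (cube_to_sphere k (\<lambda>_. 0)) = juxtapose k f g (\<lambda>_. 0)"
    using t(1) by (rule loop_mult_cube_to_sphere) (simp add: assms)
  then show ?thesis
    using juxtapose_boundary[OF t(2), of f y g] assms cube_to_sphere_boundary[OF t(2)] by simp
qed

lemma phomotopic_loop_mult:
  assumes k: "k \<ge> 1" and f: "phomotopic (psphere k) A f f'" and g: "phomotopic (psphere k) A g g'"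
  shows "phomotopic (psphere k) A (loop_mult k f g) (loop_mult k f' g')"
proof -
  obtain h where h: "continuous_map (prod_topology (top_of_set {0..1}) (nsphere k)) (fst A) h"
      "\<And>s. h (0, s) = f s" "\<And>s. h (1, s) = f' s"
      "\<And>u. u \<in> {0..1 :: real} \<Longrightarrow> h (u, sphere_base) = snd A"
    using f unfolding phomotopic_def homotopic_with_def by auto
  obtain h' where h': "continuous_map (prod_topology (top_of_set {0..1}) (nsphere k)) (fst A) h'"
      "\<And>s. h' (0, s) = g s" "\<And>s. h' (1, s) = g' s"
      "\<And>u. u \<in> {0..1 :: real} \<Longrightarrow> h' (u, sphere_base) = snd A"
    using g unfolding phomotopic_def homotopic_with_def by auto
  let ?H = "\<lambda>(u, s). loop_mult k (\<lambda>s. h (u, s)) (\<lambda>s. h' (u, s)) s"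
  have "continuous_map (prod_topology (top_of_set {0..1}) (nsphere k)) (fst A) ?H"
    using k compact_Icc h(1) h'(1) h(4) h'(4) by (rule continuous_map_loop_mult)
  moreover have "?H (u, sphere_base) = snd A" if "u \<in> {0..1}" for u
    using loop_mult_base[OF k] h(4)[OF that] h'(4)[OF that] by simp
  ultimately show ?thesis
    unfolding phomotopic_def homotopic_with_def
    by (intro exI[of _ ?H]) (simp add: h(2,3) h'(2,3))
qed

text \<open>Continuity is read off from the homotopy of the product with itself that
  \<open>phomotopic_loop_mult\<close> yields for reflexive homotopies.\<close>

lemma loop_mult_in_pmaps:
  assumes k: "k \<ge> 1" and f: "f \<in> pmaps (psphere k) A" and g: "g \<in> pmaps (psphere k) A"
  shows "loop_mult k f g \<in> pmaps (psphere k) A"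
proof -
  have "phomotopic (psphere k) A (loop_mult k f g) (loop_mult k f g)"
    by (intro phomotopic_loop_mult k phomotopic_refl f g)
  then have "continuous_map (nsphere k) (fst A) (loop_mult k f g)"
    using homotopic_with_imp_continuous_maps unfolding phomotopic_def by fastforce
  moreover have "loop_mult k f g sphere_base = snd A"
    using f g by (intro loop_mult_base k) (auto simp: pmaps_def)
  ultimately show ?thesis
    by (simp add: pmaps_def cmaps_def loop_mult_def)
qed

lemma pi_mult_hclass:
  assumes k: "k \<ge> 1" and f: "f \<in> pmaps (psphere k) A" and g: "g \<in> pmaps (psphere k) A"
  shows "hclass (psphere k) A f \<otimes>\<^bsub>pi_group k A\<^esub> hclass (psphere k) A g =
    hclass (psphere k) A (loop_mult k f g)"
proof -
  have eq: "hclass (psphere k) A (loop_mult k f' g') = hclass (psphere k) A (loop_mult k f g)"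
    if "f' \<in> hclass (psphere k) A f" "g' \<in> hclass (psphere k) A g" for f' g'
    using phomotopic_loop_mult[OF k mem_hclassD(2)[OF that(1)] mem_hclassD(2)[OF that(2)]]
    by (rule hclass_cong[symmetric])
  have "hclass (psphere k) A f \<noteq> {}" "hclass (psphere k) A g \<noteq> {}"
    using f g hclass_self by blast+
  then have "(\<Union>f'\<in>hclass (psphere k) A f. \<Union>g'\<in>hclass (psphere k) A g.
      hclass (psphere k) A (loop_mult k f' g')) = hclass (psphere k) A (loop_mult k f g)"
    by (intro SUP_eq_const eq)
  then show ?thesis
    by (simp add: pi_group_def)
qed

text \<open>An equality of maps and not only of classes: both sides pick the same preimage, and
  postcomposition passes through the case distinction.\<close>

lemma compose_loop_mult:
  "compose (topspace (nsphere k)) a (loop_mult k f g) =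
   loop_mult k (compose (topspace (nsphere k)) a f) (compose (topspace (nsphere k)) a g)"
  by (auto simp: compose_def loop_mult_def Let_def cube_to_sphere_in_nsphere fun_eq_iff)

lemma hTop_comp_mult:
  assumes k: "k \<ge> 1" and c: "c \<in> hTop_hom (psphere k) B" and d: "d \<in> hTop_hom (psphere k) B"
    and e: "e \<in> hTop_hom B C"
  shows "hTop_comp (psphere k) C e (c \<otimes>\<^bsub>pi_group k B\<^esub> d) =
    hTop_comp (psphere k) C e c \<otimes>\<^bsub>pi_group k C\<^esub> hTop_comp (psphere k) C e d"
proof -
  let ?S = "topspace (nsphere k)"
  obtain f where f: "f \<in> pmaps (psphere k) B" "c = hclass (psphere k) B f"
    using c by (rule hTop_homE)
  obtain g where g: "g \<in> pmaps (psphere k) B" "d = hclass (psphere k) B g"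
    using d by (rule hTop_homE)
  obtain a where a: "a \<in> pmaps B C" "e = hclass B C a"
    using e by (rule hTop_homE)
  have closed: "compose ?S a u \<in> pmaps (psphere k) C" if "u \<in> pmaps (psphere k) B" for u
    using pmaps_compose[OF pointed_psphere that a(1)] by (simp only: fst_conv)
  have comp: "hTop_comp (psphere k) C e (hclass (psphere k) B u) = hclass (psphere k) C (compose ?S a u)"
    if "u \<in> pmaps (psphere k) B" for u
    using hTop_comp_hclass[OF pointed_psphere that a(1)] unfolding a(2) by (simp only: fst_conv)
  have "hTop_comp (psphere k) C e (c \<otimes>\<^bsub>pi_group k B\<^esub> d) =
      hclass (psphere k) C (compose ?S a (loop_mult k f g))"
    unfolding f(2) g(2) pi_mult_hclass[OF k f(1) g(1)] by (rule comp[OF loop_mult_in_pmaps[OF k f(1) g(1)]])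
  also have "\<dots> = hTop_comp (psphere k) C e c \<otimes>\<^bsub>pi_group k C\<^esub> hTop_comp (psphere k) C e d"
    unfolding f(2) g(2) comp[OF f(1)] comp[OF g(1)] compose_loop_mult
    by (rule pi_mult_hclass[OF k closed[OF f(1)] closed[OF g(1)], symmetric])
  finally show ?thesis .
qed

lemma (in two_expansions) transfer_mult:
  assumes k: "k \<ge> 1" and F: "F \<in> Sh (psphere k) R" and G: "G \<in> Sh (psphere k) R"
  shows "transfer (psphere k) (F \<otimes>\<^bsub>shape_group k R\<^esub> G) =
    transfer (psphere k) F \<otimes>\<^bsub>shape_group k S\<^esub> transfer (psphere k) G"
proof
  fix i
  show "transfer (psphere k) (F \<otimes>\<^bsub>shape_group k R\<^esub> G) i =
      (transfer (psphere k) F \<otimes>\<^bsub>shape_group k S\<^esub> transfer (psphere k) G) i"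
  proof (cases "i \<in> idx S")
    case True
    note f = factorization[OF True]
    show ?thesis
      using hTop_comp_mult[OF k E.Sh_hom[OF F f(1)] E.Sh_hom[OF G f(1)] f(2)] True f(1)
      by (simp add: transfer_def shape_group_def)
  qed (simp add: transfer_def shape_group_def)
qed

section \<open>The topologies\<close>

lemma product_topology_cong:
  assumes "\<And>i. i \<in> I \<Longrightarrow> T i = T' i"
  shows "product_topology T I = product_topology T' I"
proof -
  have "{i \<in> I. U i \<noteq> topspace (T i)} = {i \<in> I. U i \<noteq> topspace (T' i)}" for U
    using assms by auto
  moreover have "(\<forall>i\<in>I. openin (T i) (U i)) \<longleftrightarrow> (\<forall>i\<in>I. openin (T' i) (U i))" for U
    using assms by auto
  ultimately show ?thesis
    unfolding topology_eq openin_product_topology_alt by (simp only:) simp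
qed

section \<open>The shape topology within one expansion\<close>

context expansion
begin

lemma topspace_shape_topology: "topspace (shape_topology k S) = Sh (psphere k) S"
proof -
  note openin = openin_shape_topology[OF directed, of k]
  have "openin (shape_topology k S) (Sh (psphere k) S)"
    unfolding openin arbitrary_union_of_alt
  proof
    fix F assume F: "F \<in> Sh (psphere k) S"
    obtain i where i: "i \<in> idx S"
      using directed by (auto simp: directed_set_def)
    show "\<exists>U. shape_basis k S U \<and> F \<in> U \<and> U \<subseteq> Sh (psphere k) S"
      using F i by (intro exI[of _ "shape_nbhd k S i F"]) (auto simp: shape_basis_def shape_nbhd_def)
  qed
  moreover have "U \<subseteq> Sh (psphere k) S" if "openin (shape_topology k S) U" for U
    using that unfolding openin arbitrary_union_of_alt shape_basis_def shape_nbhd_def by fastforce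
  ultimately show ?thesis
    by (metis openin_subset openin_topspace subset_antisym)
qed

lemma openin_shape_nbhd:
  assumes "i \<in> idx S"
  shows "openin (shape_topology k S) {G \<in> Sh (psphere k) S. G i = c}"
proof (cases "\<exists>F \<in> Sh (psphere k) S. F i = c")
  case True
  then obtain F where "F \<in> Sh (psphere k) S" "F i = c"
    by blast
  then have "shape_basis k S {G \<in> Sh (psphere k) S. G i = c}"
    using assms unfolding shape_basis_def shape_nbhd_def by (intro bexI[of _ i] bexI[of _ F]) auto
  then show ?thesis
    unfolding openin_shape_topology[OF directed] by (rule arbitrary_union_of_inc)
next
  case False
  then have "{G \<in> Sh (psphere k) S. G i = c} = {}"
    by blast
  then show ?thesis
    by (simp only: openin_empty)
qed

lemma continuous_map_shape_coordinate:
  assumes i: "i \<in> idx S"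
  shows "continuous_map (shape_topology k S) (discrete_topology (hTop_hom (psphere k) (obj S i))) (\<lambda>F. F i)"
  unfolding continuous_map_def topspace_shape_topology
proof (intro conjI allI impI)
  show "(\<lambda>F. F i) \<in> Sh (psphere k) S \<rightarrow> topspace (discrete_topology (hTop_hom (psphere k) (obj S i)))"
    unfolding topspace_discrete_topology using Sh_hom[OF _ i] by (rule Pi_I)
  fix U
  have "openin (shape_topology k S) (\<Union>c\<in>U. {F \<in> Sh (psphere k) S. F i = c})"
    using openin_shape_nbhd[OF i] by (intro openin_Union) auto
  moreover have "(\<Union>c\<in>U. {F \<in> Sh (psphere k) S. F i = c}) = {F \<in> Sh (psphere k) S. F i \<in> U}"
    by blast
  ultimately show "openin (shape_topology k S) {F \<in> Sh (psphere k) S. F i \<in> U}"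
    by (simp only:)
qed

text \<open>A basic open set of the product restricts finitely many coordinates, a basic set of the
  shape topology only one. They generate the same topology on compatible families because the
  coordinate at an upper bound determines those below it; this use of directedness is contained in
  \<open>openin_shape_topology\<close>.\<close>

lemma shape_topology_eq_product:
  "shape_topology k S =
    subtopology (product_topology (\<lambda>i. discrete_topology (hTop_hom (psphere k) (obj S i))) (idx S))
      (Sh (psphere k) S)" (is "_ = subtopology (product_topology ?D _) _")
proof -
  let ?L = "subtopology (product_topology ?D (idx S)) (Sh (psphere k) S)"
  have top: "topspace ?L = Sh (psphere k) S"
    by (auto simp: Sh_def)
  show ?thesis
    unfolding topology_eq
  proof (intro allI iffI)
    fix U assume U: "openin ?L U"
    have "(\<lambda>F. F) ` topspace (shape_topology k S) \<subseteq> extensional (idx S)"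
      unfolding topspace_shape_topology by (auto simp: Sh_def PiE_def)
    then have "continuous_map (shape_topology k S) ?L (\<lambda>F. F)"
      unfolding continuous_map_in_subtopology continuous_map_componentwise topspace_shape_topology
      using continuous_map_shape_coordinate by auto
    from openin_continuous_map_preimage[OF this U]
    have "openin (shape_topology k S) {F \<in> Sh (psphere k) S. F \<in> U}"
      by (simp only: topspace_shape_topology)
    moreover have "{F \<in> Sh (psphere k) S. F \<in> U} = U"
      using openin_subset[OF U] unfolding top by blast
    ultimately show "openin (shape_topology k S) U"
      by (simp only:)
  next
    have basis: "openin ?L B" if basic: "shape_basis k S B" for B
    proof -
      obtain i F where i: "i \<in> idx S" and F: "F \<in> Sh (psphere k) S" and B: "B = shape_nbhd k S i F"
        using basic unfolding shape_basis_def by blast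
      have "continuous_map ?L (?D i) (\<lambda>G. G i)"
        using i by (intro continuous_map_from_subtopology continuous_map_product_projection)
      moreover have "openin (?D i) {F i}"
        using Sh_hom[OF F i] by simp
      ultimately have "openin ?L {G \<in> topspace ?L. G i \<in> {F i}}"
        by (rule openin_continuous_map_preimage)
      moreover have "{G \<in> topspace ?L. G i \<in> {F i}} = B"
        unfolding B shape_nbhd_def top by auto
      ultimately show ?thesis
        by (simp only:)
    qed
    fix U assume "openin (shape_topology k S) U"
    then obtain \<U> where "\<And>B. B \<in> \<U> \<Longrightarrow> shape_basis k S B" "\<Union>\<U> = U"
      unfolding openin_shape_topology[OF directed] union_of_def by auto
    then show "openin ?L U"
      using basis openin_Union by metis
  qed
qed

text \<open>Both topologies live on literally the same set of families, so discreteness at each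
  index gives equality and not only a homeomorphism.\<close>

lemma lim_pi_qtop_eq: "lim_pi_qtop k S = shape_topology k S"
proof -
  let ?D = "\<lambda>i. discrete_topology (hTop_hom (psphere k) (obj S i))"
  have discrete: "pi_qtop k (obj S i) = ?D i" if "i \<in> idx S" for i
    by (rule pi_qtop_discrete[OF HPol_obj[OF that]])
  have "product_topology (\<lambda>i. pi_qtop k (obj S i)) (idx S) = product_topology ?D (idx S)"
    by (rule product_topology_cong) (rule discrete)
  moreover have "invlim_carrier (idx S) (idx_le S) (\<lambda>i. topspace (pi_qtop k (obj S i))) (pi_bond k S) =
      Sh (psphere k) S"
  proof -
    have "Pi\<^sub>E (idx S) (\<lambda>i. topspace (pi_qtop k (obj S i))) =
        Pi\<^sub>E (idx S) (\<lambda>i. hTop_hom (psphere k) (obj S i))"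
      by (rule PiE_cong) (simp add: discrete)
    then show ?thesis
      unfolding invlim_carrier_def Sh_def pi_bond_def by (simp only:)
  qed
  ultimately show ?thesis
    unfolding lim_pi_qtop_def invlim_topology_def shape_topology_eq_product by (simp only:)
qed

end

lemma lim_pi_group_eq: "lim_pi_group k S = shape_group k S"
  by (simp add: lim_pi_group_def invlim_group_def invlim_carrier_def shape_group_def Sh_def
      pi_group_def pi_bond_def)

text \<open>Each coordinate of the transferred family depends on a single coordinate of
  \<open>F\<close>, through a map between discrete spaces.\<close>

lemma (in two_expansions) continuous_map_transfer:
  "continuous_map (shape_topology k R) (shape_topology k S) (transfer (psphere k))"
proof -
  have closed: "transfer (psphere k) F \<in> Sh (psphere k) S" if "F \<in> Sh (psphere k) R" for F
    using pointed_psphere that by (rule transfer_in_Sh)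
  let ?D = "\<lambda>i. discrete_topology (hTop_hom (psphere k) (obj S i))"
  have "continuous_map (shape_topology k R) (?D i) (\<lambda>F. transfer (psphere k) F i)"
    if i: "i \<in> idx S" for i
  proof -
    note f = factorization[OF i]
    have "continuous_map (discrete_topology (hTop_hom (psphere k) (obj R (fac_idx i)))) (?D i)
        (hTop_comp (psphere k) (obj S i) (fac_map i))"
      using hTop_comp_closed[OF pointed_psphere _ f(2)] by simp
    from continuous_map_compose[OF E.continuous_map_shape_coordinate[OF f(1)] this]
    show ?thesis
      using i by (simp add: transfer_def o_def)
  qed
  then show ?thesis
    unfolding D.shape_topology_eq_product continuous_map_in_subtopology continuous_map_componentwise
      E.topspace_shape_topology
    using closed by (auto simp: transfer_def)
qed

theorem theorem3p7:
  fixes A :: "'a pspace"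
    and S :: "('l, 'p) inv_sys" and p :: "'l \<Rightarrow> ('a \<Rightarrow> 'p) set"
    and R :: "('m, 'p) inv_sys" and q :: "'m \<Rightarrow> ('a \<Rightarrow> 'p) set"
    and k :: nat
  assumes "pointed_space A"
    and "HPol_expansion TYPE('v) A S p"
    and "HPol_expansion TYPE('v) A R q"
    and "k \<ge> 1"
  shows "topological_group_isomorphic
           (shape_group k R) (shape_topology k R)
           (lim_pi_group k S) (lim_pi_qtop k S)"
proof -
  have S: "expansion TYPE('v) A S p" and R: "expansion TYPE('v) A R q"
    by (rule expansion.intro; fact)+
  have RS: "two_expansions TYPE('v) A R q S p"
    using R S by (rule two_expansions.intro)
  have SR: "two_expansions TYPE('v) A S p R q"
    using S R by (rule two_expansions.intro)
  \<comment> \<open>With the limit rewritten as the shape group of \<open>S\<close> and its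
    topology, what remains is to compare \<open>R\<close> with \<open>S\<close>; the two directions
    of transfer are inverse to each other.\<close>
  let ?\<phi> = "two_expansions.transfer A R q S p (psphere k)"
  let ?\<psi> = "two_expansions.transfer A S p R q (psphere k)"
  note top = expansion.topspace_shape_topology[OF R, of k] expansion.topspace_shape_topology[OF S, of k]
  have "?\<phi> \<in> iso (shape_group k R) (shape_group k S)"
  proof (rule isoI)
    have carrier: "carrier (shape_group k R) = Sh (psphere k) R" "carrier (shape_group k S) = Sh (psphere k) S"
      by (simp_all add: shape_group_def)
    show "?\<phi> \<in> hom (shape_group k R) (shape_group k S)"
    proof (rule homI)
      fix F G assume FG: "F \<in> carrier (shape_group k R)" "G \<in> carrier (shape_group k R)"
      show "?\<phi> F \<in> carrier (shape_group k S)"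
        using two_expansions.transfer_in_Sh[OF RS pointed_psphere] FG(1) unfolding carrier .
      show "?\<phi> (F \<otimes>\<^bsub>shape_group k R\<^esub> G) = ?\<phi> F \<otimes>\<^bsub>shape_group k S\<^esub> ?\<phi> G"
        using two_expansions.transfer_mult[OF RS assms(4)] FG unfolding carrier .
    qed
    show "bij_betw ?\<phi> (carrier (shape_group k R)) (carrier (shape_group k S))"
      unfolding carrier using RS SR pointed_psphere by (rule bij_betw_transfer)
  qed
  moreover have "homeomorphic_maps (shape_topology k R) (shape_topology k S) ?\<phi> ?\<psi>"
    unfolding homeomorphic_maps_def top
    using two_expansions.continuous_map_transfer[OF RS, of k]
      two_expansions.continuous_map_transfer[OF SR, of k]
      transfer_inverse[OF RS SR pointed_psphere] transfer_inverse[OF SR RS pointed_psphere]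
    by (intro conjI ballI)
  then have "homeomorphic_map (shape_topology k R) (shape_topology k S) ?\<phi>"
    by (rule homeomorphic_maps_map[THEN iffD1, THEN conjunct1])
  ultimately show ?thesis
    unfolding topological_group_isomorphic_def lim_pi_group_eq expansion.lim_pi_qtop_eq[OF S]
    by (intro bexI)
qed

end
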